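(* Let $G=\sum_{i=1}^m *:(x_i)+\sum_{j=1}^n *:(-y_j)+A$ be a disjunctive sum of Generalized Sprigs and Stalks, where $0<x_1\le\cdots\le x_m$, $0<y_1\le\cdots\le y_n$, no $x_i$ equals any $y_j$, and $A$ is a disjunctive sum of Stalks with nim-sum $a$. Let $\Delta(G)=m-n$ and $\epsilon(G)=\min_i x_i-\min_j y_j$ (with $\epsilon(G)=0$ if $m=0$ or $n=0$). Then: (i) If $|\Delta(G)|\ge2$: $o^+(G)=o^-(G^* )=\mathcal L$ if $\Delta(G)\ge2$ and $=\mathcal R$ if $\Delta(G)\le-2$. (ii) If $|\Delta(G)|=1$: $o^+(G)=o^-(G^* )$ equals $\mathcal N$ if ($\Delta(G)=1$, $\epsilon(G)\le0$, $a=0$) or ($\Delta(G)=-1$, $\epsilon(G)\ge0$, $a=0$); equals $\mathcal L$ if ($\Delta(G)=1$, $\epsilon(G)>0$, $a=0$) or ($\Delta(G)=1$, $a\ne0$); equals $\mathcal R$ if ($\Delta(G)=-1$, $\epsilon(G)<0$, $a=0$) or ($\Delta(G)=-1$, $a\ne0$). (iii) If $\Delta(G)=0$: $o^+(G)=o^-(G^* )$ equals $\mathcal N$ if $a\ne0$; $\mathcal P$ if $\epsilon(G)=0$ and $a=0$; $\mathcal L$ if $\epsilon(G)>0$ and $a=0$; $\mathcal R$ if $\epsilon(G)<0$ and $a=0$.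
   Context: Hackenbush: finite graph with blue, red or green edges and ground vertices; Left cuts blue or green edges, Right cuts red or green; components disconnected from the ground are discarded. Normal play: last mover wins; misère play: last mover loses. $o^+$, $o^-$ denote the outcome classes $\mathcal N,\mathcal P,\mathcal L,\mathcal R$ under each convention. A Stalk of height $h$ is a path of $h$ green edges with one endpoint on the ground; the nim-sum of a sum of Stalks is the bitwise XOR of their heights; $*$ is a Stalk of height $1$. A Generalized Sprig $*:(x)$ is a single green edge on the ground whose top vertex supports a red–blue Hackenbush position (its Blossom) with normal-play value $x$. The evil twin is $G^*=G$ if some Stalk in $A$ has height at least $2$, and $G^*=G+*$ otherwise. *)

theory Defs
  imports Complex_Main "HOL-Library.FSet" "HOL-Library.Multiset"
begin

section \<open>Short combinatorial games\<close>

datatype player = Left | Right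

fun opponent :: "player \<Rightarrow> player" where
  "opponent Left = Right"
| "opponent Right = Left"

datatype game = Game (left_opts: "game fset") (right_opts: "game fset")

fun opts :: "player \<Rightarrow> game \<Rightarrow> game fset" where
  "opts Left G = left_opts G"
| "opts Right G = right_opts G"

lemma size_option_less [termination_simp]:
  assumes "G' |\<in>| opts p G"
  shows "size G' < size G"
proof -
  obtain L R where G: "G = Game L R" by (cases G)
  have *: "size G' < Suc (\<Sum>x\<in>fset X. Suc (size x))" if "G' |\<in>| X" for X
  proof -
    have "Suc (size G') \<le> (\<Sum>x\<in>fset X. Suc (size x))"
      using that by (intro member_le_sum) auto
    then show ?thesis by simp
  qed
  show ?thesis
    using assms *[of L] *[of R] by (cases p) (auto simp: G)
qed

lemma size_left_option_less [termination_simp]: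
  "G' |\<in>| left_opts G \<Longrightarrow> size G' < size G"
  using size_option_less[of G' Left G] by simp

lemma size_right_option_less [termination_simp]:
  "G' |\<in>| right_opts G \<Longrightarrow> size G' < size G"
  using size_option_less[of G' Right G] by simp

subsection \<open>Disjunctive sum\<close>

function game_add :: "game \<Rightarrow> game \<Rightarrow> game" where
  "game_add G H = Game
     ((\<lambda>G'. game_add G' H) |`| left_opts G |\<union>| (\<lambda>H'. game_add G H') |`| left_opts H)
     ((\<lambda>G'. game_add G' H) |`| right_opts G |\<union>| (\<lambda>H'. game_add G H') |`| right_opts H)"
  by pat_completeness auto
termination
  by (relation "measure (\<lambda>(G, H). size G + size H)")
     (auto simp: size_left_option_less size_right_option_less)

declare game_add.simps [simp del]

lemma left_opts_add:
  "left_opts (game_add G H) =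
     (\<lambda>G'. game_add G' H) |`| left_opts G |\<union>| (\<lambda>H'. game_add G H') |`| left_opts H"
  by (subst game_add.simps) simp

lemma right_opts_add:
  "right_opts (game_add G H) =
     (\<lambda>G'. game_add G' H) |`| right_opts G |\<union>| (\<lambda>H'. game_add G H') |`| right_opts H"
  by (subst game_add.simps) simp

lemma game_add_commute: "game_add G H = game_add H G"
proof (induction G H rule: game_add.induct)
  case (1 G H)
  show ?case
    by (rule game.expand)
       (simp add: left_opts_add right_opts_add 1 funion_commute cong: fset.map_cong)
qed

lemma game_add_assoc: "game_add (game_add G H) K = game_add G (game_add H K)"
proof (induction "size G + size H + size K" arbitrary: G H K rule: less_induct)
  case less
  have 1: "game_add (game_add G' H) K = game_add G' (game_add H K)"
    if "G' |\<in>| left_opts G \<or> G' |\<in>| right_opts G" for G'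
    using that by (intro less) (auto dest: size_left_option_less size_right_option_less)
  have 2: "game_add (game_add G H') K = game_add G (game_add H' K)"
    if "H' |\<in>| left_opts H \<or> H' |\<in>| right_opts H" for H'
    using that by (intro less) (auto dest: size_left_option_less size_right_option_less)
  have 3: "game_add (game_add G H) K' = game_add G (game_add H K')"
    if "K' |\<in>| left_opts K \<or> K' |\<in>| right_opts K" for K'
    using that by (intro less) (auto dest: size_left_option_less size_right_option_less)
  show ?case
    by (rule game.expand)
       (simp add: left_opts_add right_opts_add fimage_funion fset.map_comp comp_def
          funion_assoc 1 2 3 cong: fset.map_cong)
qed

lemma game_add_zero: "game_add (Game {||} {||}) G = G"
proof (induction G)
  case (Game L R)
  then show ?case
    by (subst game_add.simps) (auto simp: cong: fset.map_cong)
qed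

instantiation game :: "{comm_monoid_add, uminus}"
begin

definition zero_game :: game where
  "0 = Game {||} {||}"

definition plus_game :: "game \<Rightarrow> game \<Rightarrow> game" where
  "G + H = game_add G H"

primrec uminus_game :: "game \<Rightarrow> game" where
  "- (Game L R) = Game (uminus |`| R) (uminus |`| L)"

instance
proof
  fix G H K :: game
  show "G + H + K = G + (H + K)"
    by (simp only: plus_game_def game_add_assoc)
  show "G + H = H + G"
    unfolding plus_game_def by (rule game_add_commute)
  show "0 + G = G"
    by (simp only: plus_game_def zero_game_def game_add_zero)
qed

end

subsection \<open>Outcomes\<close>

datatype convention = Normal | Misere

function wins_moving_first :: "convention \<Rightarrow> player \<Rightarrow> game \<Rightarrow> bool" where
  "wins_moving_first c p G \<longleftrightarrow>
     (c = Misere \<and> opts p G = {||}) \<or>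
     (\<exists>G' |\<in>| opts p G. \<not> wins_moving_first c (opponent p) G')"
  by pat_completeness auto
termination
  by (relation "measure (\<lambda>(c, p, G). size G)") (auto simp: size_option_less)

declare wins_moving_first.simps [simp del]

datatype outcome = \<N> | \<P> | \<L> | \<R>

definition outcome :: "convention \<Rightarrow> game \<Rightarrow> outcome" where
  "outcome c G =
     (if wins_moving_first c Left G
      then (if wins_moving_first c Right G then \<N> else \<L>)
      else (if wins_moving_first c Right G then \<R> else \<P>))"

abbreviation normal_outcome :: "game \<Rightarrow> outcome"  (\<open>o\<^sup>+\<close>) where
  "o\<^sup>+ \<equiv> outcome Normal"

abbreviation misere_outcome :: "game \<Rightarrow> outcome"  (\<open>o\<^sup>-\<close>) where
  "o\<^sup>- \<equiv> outcome Misere"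

subsection \<open>Normal-play values\<close>

definition normal_equal :: "game \<Rightarrow> game \<Rightarrow> bool" where
  "normal_equal G H \<longleftrightarrow> (\<forall>X. o\<^sup>+ (G + X) = o\<^sup>+ (H + X))"

primrec nat_game :: "nat \<Rightarrow> game" where
  "nat_game 0 = 0"
| "nat_game (Suc n) = Game {|nat_game n|} {||}"

definition int_game :: "int \<Rightarrow> game" where
  "int_game i = (if 0 \<le> i then nat_game (nat i) else - nat_game (nat (- i)))"

text \<open>
  The canonical form of the number \<open>i / 2 ^ k\<close>.  For odd \<open>i\<close> it has the unique Left option
  \<open>(i - 1) / 2 ^ (k + 1)\<close> and the unique Right option \<open>(i + 1) / 2 ^ (k + 1)\<close>, written below
  with denominator \<open>2 ^ k\<close>.
\<close>
fun dyadic_game :: "int \<Rightarrow> nat \<Rightarrow> game" where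
  "dyadic_game i 0 = int_game i"
| "dyadic_game i (Suc k) =
     (if even i then dyadic_game (i div 2) k
      else Game {|dyadic_game ((i - 1) div 2) k|} {|dyadic_game ((i + 1) div 2) k|})"

definition has_normal_value :: "game \<Rightarrow> rat \<Rightarrow> bool" where
  "has_normal_value G x \<longleftrightarrow>
     (\<exists>i k. x = of_int i / 2 ^ k \<and> normal_equal G (dyadic_game i k))"


section \<open>Hackenbush\<close>

datatype colour = Blue | Red | Green

text \<open>Edges are undirected: the order of the two end vertices carries no meaning.\<close>
datatype 'v edge = Edge (end1: 'v) (end2: 'v) (colour: colour)

text \<open>A finite multigraph; parallel edges of equal colour are counted by multiplicity.\<close>
record 'v hackenbush =
  ground :: "'v set"
  edges :: "'v edge multiset"

definition adjacency :: "'v edge multiset \<Rightarrow> ('v \<times> 'v) set" where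
  "adjacency E = {(u, v). \<exists>c. Edge u v c \<in># E \<or> Edge v u c \<in># E}"

definition grounded_vertices :: "'v set \<Rightarrow> 'v edge multiset \<Rightarrow> 'v set" where
  "grounded_vertices S E = (adjacency E)\<^sup>* `` S"

definition discard_ungrounded :: "'v hackenbush \<Rightarrow> 'v hackenbush" where
  "discard_ungrounded H = H\<lparr>edges :=
     {# e \<in># edges H. end1 e \<in> grounded_vertices (ground H) (edges H) #}\<rparr>"

definition hackenbush_position :: "'v hackenbush \<Rightarrow> bool" where
  "hackenbush_position H \<longleftrightarrow> finite (ground H) \<and> discard_ungrounded H = H"

definition red_blue :: "'v hackenbush \<Rightarrow> bool" where
  "red_blue H \<longleftrightarrow> (\<forall>e \<in># edges H. colour e \<noteq> Green)"

definition cut :: "'v edge \<Rightarrow> 'v hackenbush \<Rightarrow> 'v hackenbush" where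
  "cut e H = discard_ungrounded (H\<lparr>edges := edges H - {#e#}\<rparr>)"

fun may_cut :: "player \<Rightarrow> colour \<Rightarrow> bool" where
  "may_cut Left c \<longleftrightarrow> c = Blue \<or> c = Green"
| "may_cut Right c \<longleftrightarrow> c = Red \<or> c = Green"

definition cuttable :: "player \<Rightarrow> 'v hackenbush \<Rightarrow> 'v edge fset" where
  "cuttable p H = Abs_fset {e. e \<in># edges H \<and> may_cut p (colour e)}"

lemma cuttable_iff: "e |\<in>| cuttable p H \<longleftrightarrow> e \<in># edges H \<and> may_cut p (colour e)"
proof -
  have "finite {e. e \<in># edges H \<and> may_cut p (colour e)}"
    by (rule finite_subset[of _ "set_mset (edges H)"]) auto
  then show ?thesis
    by (simp add: cuttable_def Abs_fset_inverse)
qed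

lemma size_cut_less:
  assumes "e |\<in>| cuttable p H"
  shows "size (edges (cut e H)) < size (edges H)"
proof -
  have "size (edges (cut e H)) \<le> size (edges H - {#e#})"
    by (simp add: cut_def discard_ungrounded_def size_mset_mono del: filter_diff_mset)
  also have "\<dots> < size (edges H)"
    using assms by (simp add: cuttable_iff size_Diff1_less)
  finally show ?thesis .
qed

function game_of :: "'v hackenbush \<Rightarrow> game" where
  "game_of H = Game
     ((\<lambda>e. game_of (cut e H)) |`| cuttable Left H)
     ((\<lambda>e. game_of (cut e H)) |`| cuttable Right H)"
  by pat_completeness auto
termination
  by (relation "measure (\<lambda>H. size (edges H))") (auto intro: size_cut_less)

declare game_of.simps [simp del]


section \<open>Stalks and Generalized Sprigs\<close>

definition stalk :: "nat \<Rightarrow> nat hackenbush" where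
  "stalk h = \<lparr>ground = {0}, edges = {# Edge i (Suc i) Green. i \<in># mset [0..<h] #}\<rparr>"

datatype 'v sprig_vertex = Root | Top | Inner 'v

text \<open>
  The Blossom \<open>B\<close> is planted on the top vertex of the green edge, i.e. all ground vertices
  of \<open>B\<close> are identified with that vertex.
\<close>
definition generalized_sprig :: "'v hackenbush \<Rightarrow> 'v sprig_vertex hackenbush" where
  "generalized_sprig B =
     \<lparr>ground = {Root},
      edges = add_mset (Edge Root Top Green)
        (image_mset (map_edge (\<lambda>v. if v \<in> ground B then Top else Inner v)) (edges B))\<rparr>"

definition blossom_of_value :: "'v hackenbush \<Rightarrow> rat \<Rightarrow> bool" where
  "blossom_of_value B x \<longleftrightarrow>
     hackenbush_position B \<and> red_blue B \<and> has_normal_value (game_of B) x"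

definition nim_sum :: "nat list \<Rightarrow> nat" where
  "nim_sum hs = foldr Bit_Operations.xor hs 0"

definition stalk_sum :: "nat list \<Rightarrow> game" where
  "stalk_sum hs = (\<Sum>h\<leftarrow>hs. game_of (stalk h))"

text \<open>
  The evil twin depends on the presentation of the game as a sum, through the list \<open>hs\<close>
  of the heights of its Stalks.
\<close>
definition evil_twin :: "nat list \<Rightarrow> game \<Rightarrow> game" where
  "evil_twin hs G = (if \<exists>h \<in> set hs. 2 \<le> h then G else G + game_of (stalk 1))"

definition min_difference :: "rat list \<Rightarrow> rat list \<Rightarrow> rat" where
  "min_difference xs ys =
     (if xs = [] \<or> ys = [] then 0 else Min (set xs) - Min (set ys))"

end

(*
  Count a Blossom of value 0 as a Nim heap of size 1, and let a be the Nim value of these heaps and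
  the Stalks, corrected in misere play as in misere Nim; the evil twin of G then has in misere play
  the same a as G in normal play.  With m positive and n negative Blossoms, a single induction
  serves both conventions.  Left, moving second, wins whenever m - n, a and the order of the
  smallest values satisfy the conditions of the theorem, because every move of Right can be answered
  by cutting a stem, by a Nim move, or by a move in a Blossom that does not cross zero (or, for a
  single pair x > y, does not reverse that order).

  The Blossoms reached in play are compared only through the outcomes of sums of two of them.  This
  is enough since no sum of two red-blue positions is a first-player win: cutting one's own edge
  never improves one's position.  Numerical values enter only for the initial Blossoms.
*)
theory Submission
  imports Defs
begin

section \<open>Options of sums and of normal play\<close>

text \<open>The positions of the statement are not closed under play: Blossoms can reach 0 or change
  sign, and values of the two signs can come to coincide. The strategy of a player \<open>p\<close>
  is arranged so that this does no harm. Apart from Nim moves, a Blossom is entered in two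
  situations only. When no Blossom favours the opponent and at most two favour \<open>p\<close>, the
  Nim value may have to be repaired. Moving in an own Blossom without crossing zero works whether or
  not it lands on 0, since landing there costs one Blossom but toggles the Nim value. When one
  Blossom of each sign is left and the Nim value is 0, cutting either stem loses, because the
  opponent then cuts the other one. The answer is the move that wins the ordinary sum of the two
  Blossoms. It may make the two values equal, which forces the separate weak condition
  \<open>balanced\<close> beside \<open>dominated\<close>. In all other situations with a Blossom
  favouring the opponent, one of their stems is cut, sparing the smallest value where the order
  matters.\<close>

lemma opponent_opponent [simp]: "opponent (opponent p) = p"
  by (cases p) auto

lemma opts_add:
  "opts p (G + H) = (\<lambda>G'. G' + H) |`| opts p G |\<union>| (\<lambda>H'. G + H') |`| opts p H"
  by (cases p) (simp_all add: plus_game_def left_opts_add right_opts_add)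

lemma opts_add_iff:
  "X |\<in>| opts p (G + H) \<longleftrightarrow>
     (\<exists>G'. G' |\<in>| opts p G \<and> X = G' + H) \<or> (\<exists>H'. H' |\<in>| opts p H \<and> X = G + H')"
  by (auto simp: opts_add)

lemma opts_zero [simp]: "opts p 0 = {||}"
  by (cases p) (simp_all add: zero_game_def)

lemma opts_sum_mset_iff:
  "X |\<in>| opts p (\<Sum>x\<in>#M. f x) \<longleftrightarrow>
     (\<exists>x M' Y. M = add_mset x M' \<and> Y |\<in>| opts p (f x) \<and> X = Y + (\<Sum>x\<in>#M'. f x))"
proof (induction M arbitrary: X)
  case empty
  then show ?case by simp
next
  case (add a M)
  show ?case
  proof
    assume "X |\<in>| opts p (\<Sum>x\<in>#add_mset a M. f x)"
    then consider Y where "Y |\<in>| opts p (f a)" "X = Y + (\<Sum>x\<in>#M. f x)"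
      | Y where "Y |\<in>| opts p (\<Sum>x\<in>#M. f x)" "X = f a + Y"
      by (auto simp: opts_add_iff)
    then show "\<exists>x M' Y. add_mset a M = add_mset x M' \<and> Y |\<in>| opts p (f x) \<and> X = Y + (\<Sum>x\<in>#M'. f x)"
    proof cases
      case 1
      then show ?thesis by blast
    next
      case 2
      then obtain x M' Y' where "M = add_mset x M'" "Y' |\<in>| opts p (f x)" "Y = Y' + (\<Sum>x\<in>#M'. f x)"
        using add by blast
      then show ?thesis
        using 2 by (intro exI[of _ x] exI[of _ "add_mset a M'"] exI[of _ Y'])
          (auto simp: add_mset_commute algebra_simps)
    qed
  next
    assume "\<exists>x M' Y. add_mset a M = add_mset x M' \<and> Y |\<in>| opts p (f x) \<and> X = Y + (\<Sum>x\<in>#M'. f x)"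
    then obtain x M' Y where "add_mset a M = add_mset x M'" "Y |\<in>| opts p (f x)"
      "X = Y + (\<Sum>x\<in>#M'. f x)" by blast
    moreover from this have "(\<Sum>x\<in>#add_mset a M. f x) = f x + (\<Sum>x\<in>#M'. f x)" by simp
    ultimately show "X |\<in>| opts p (\<Sum>x\<in>#add_mset a M. f x)"
      by (metis opts_add_iff)
  qed
qed

lemma wins_normal_iff:
  "wins_moving_first Normal p G \<longleftrightarrow>
     (\<exists>G' |\<in>| opts p G. \<not> wins_moving_first Normal (opponent p) G')"
  by (subst wins_moving_first.simps) simp

lemma wins_normalI:
  "G' |\<in>| opts p G \<Longrightarrow> \<not> wins_moving_first Normal (opponent p) G' \<Longrightarrow> wins_moving_first Normal p G"
  using wins_normal_iff by blast

lemma wins_normal_after_loser_moves: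
  assumes "\<not> wins_moving_first Normal p G" "G' |\<in>| opts p G"
  shows "wins_moving_first Normal (opponent p) G'"
  using assms wins_normalI by blast

lemma wins_moving_firstI:
  "G' |\<in>| opts p G \<Longrightarrow> \<not> wins_moving_first c (opponent p) G' \<Longrightarrow> wins_moving_first c p G"
  using wins_moving_first.simps by blast

text \<open>The opponent answers in the component just played in, or starts in \<open>H\<close> if
  it is a first-player win there. Each claim leads to the other after one move, so they are proved
  together.\<close>

lemma not_wins_add:
  "(\<not> wins_moving_first Normal p G \<longrightarrow> \<not> wins_moving_first Normal p H \<longrightarrow>
      \<not> wins_moving_first Normal p (G + H)) \<and>
   (\<not> wins_moving_first Normal p G \<longrightarrow> wins_moving_first Normal (opponent p) H \<longrightarrow>
      wins_moving_first Normal (opponent p) (G + H))"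
proof (induction "size G + size H" arbitrary: G H rule: less_induct)
  case less
  show ?case
  proof (intro conjI impI)
    assume G: "\<not> wins_moving_first Normal p G" and H: "\<not> wins_moving_first Normal p H"
    show "\<not> wins_moving_first Normal p (G + H)"
    proof
      assume "wins_moving_first Normal p (G + H)"
      then obtain X where X: "X |\<in>| opts p (G + H)" "\<not> wins_moving_first Normal (opponent p) X"
        using wins_normal_iff by blast
      from X(1) show False
        unfolding opts_add_iff
      proof (elim disjE exE conjE)
        fix G' assume *: "G' |\<in>| opts p G" "X = G' + H"
        from wins_normal_after_loser_moves[OF G *(1)] have "wins_moving_first Normal (opponent p) (H + G')"
          using less[of H G'] size_option_less[OF *(1)] H by auto
        then show False using X * by (simp add: add.commute)
      next
        fix H' assume *: "H' |\<in>| opts p H" "X = G + H'"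
        from wins_normal_after_loser_moves[OF H *(1)] show False
          using less[of G H'] size_option_less[OF *(1)] G X * by auto
      qed
    qed
  next
    assume G: "\<not> wins_moving_first Normal p G" and H: "wins_moving_first Normal (opponent p) H"
    obtain H' where *: "H' |\<in>| opts (opponent p) H" "\<not> wins_moving_first Normal p H'"
      using H wins_normal_iff[of "opponent p" H] by auto
    have "\<not> wins_moving_first Normal p (G + H')"
      using less[of G H'] size_option_less[OF *(1)] G * by auto
    then show "wins_moving_first Normal (opponent p) (G + H)"
      using * by (intro wins_normalI[of "G + H'"]) (auto simp: opts_add_iff)
  qed
qed

section \<open>Sums of dyadic numbers\<close>

fun player_sign :: "player \<Rightarrow> int" where
  "player_sign Left = 1"
| "player_sign Right = -1"

lemma player_sign_opponent [simp]: "player_sign (opponent p) = - player_sign p"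
  by (cases p) auto

lemma opts_dyadic_game_0:
  "opts p (dyadic_game i 0) =
     (if player_sign p * i > 0 then {|dyadic_game (i - player_sign p) 0|} else {||})"
proof -
  consider n where "i = int (Suc n)" | "i = 0" | n where "i = - int (Suc n)"
    by (metis int_cases not0_implies_Suc of_nat_0)
  then show ?thesis
  proof cases
    case 1
    then show ?thesis
      by (cases p) (simp_all add: int_game_def nat_add_distrib)
  next
    case 2
    then show ?thesis by (simp add: int_game_def)
  next
    case 3
    then show ?thesis
      by (cases p; cases n) (simp_all add: int_game_def nat_add_distrib zero_game_def)
  qed
qed

lemma opts_dyadic_game_Suc:
  "odd i \<Longrightarrow> opts p (dyadic_game i (Suc k)) = {|dyadic_game ((i - player_sign p) div 2) k|}"
  by (cases p) simp_all

definition dyadic :: "int \<Rightarrow> nat \<Rightarrow> rat" where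
  "dyadic i k = of_int i / 2 ^ k"

text \<open>\<open>dyadic_game\<close> strips factors 2 from the numerator; the options can be read
  off only at a reduced representation.\<close>

lemma dyadic_game_reduced:
  "\<exists>j l. dyadic_game i k = dyadic_game j l \<and> dyadic i k = dyadic j l \<and> (l = 0 \<or> odd j)"
proof (induction k arbitrary: i)
  case 0
  then show ?case by blast
next
  case (Suc k)
  show ?case
  proof (cases "even i")
    case True
    then have "dyadic i (Suc k) = dyadic (i div 2) k"
      by (auto simp: dyadic_def elim!: evenE)
    moreover have "dyadic_game i (Suc k) = dyadic_game (i div 2) k"
      using True by simp
    ultimately show ?thesis using Suc[of "i div 2"] by metis
  qed blast
qed

lemma dyadic_Suc_option:
  assumes "odd i"
  shows "dyadic ((i - player_sign p) div 2) k = dyadic i (Suc k) - of_int (player_sign p) / 2 ^ Suc k"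
  using assms by (cases p) (auto simp: dyadic_def field_simps elim!: oddE)

lemma dyadic_game_option:
  assumes "X |\<in>| opts p (dyadic_game i k)"
  shows "\<exists>j l. X = dyadic_game j l \<and> of_int (player_sign p) * (dyadic j l - dyadic i k) < 0"
proof -
  obtain j l where jl: "dyadic_game i k = dyadic_game j l" "dyadic i k = dyadic j l" "l = 0 \<or> odd j"
    using dyadic_game_reduced by blast
  show ?thesis
  proof (cases l)
    case 0
    then have "X = dyadic_game (j - player_sign p) 0"
      using assms unfolding jl(1) 0 opts_dyadic_game_0 by (auto split: if_splits)
    then show ?thesis
      unfolding jl 0 by (intro exI[of _ "j - player_sign p"] exI[of _ 0]) (cases p; simp add: dyadic_def)
  next
    case (Suc l')
    then have j: "odd j" using jl by simp
    have "X = dyadic_game ((j - player_sign p) div 2) l'"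
      using assms unfolding jl(1) Suc opts_dyadic_game_Suc[OF j] by simp
    then show ?thesis
      unfolding jl Suc
      by (intro exI[of _ "(j - player_sign p) div 2"] exI[of _ l'])
        (cases p; simp only: dyadic_Suc_option[OF j]; simp)
  qed
qed

text \<open>Since \<open>l \<le> j\<close>, the sum is a multiple of \<open>1 / 2 ^ j\<close>, so an
  advantage of \<open>p\<close> amounts to at least \<open>1 / 2 ^ j\<close>. The move of
  \<open>p\<close> in the summand with the larger denominator costs exactly that much. In an integer
  such a move exists only if the sign is right, hence the last assumption.\<close>

lemma dyadic_game_good_option:
  assumes jl: "j = 0 \<or> odd i" "l \<le> j" and pos: "of_int (player_sign p) * (dyadic i j + dyadic k l) > 0"
    and int: "j = 0 \<Longrightarrow> player_sign p * i > 0"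
  shows "\<exists>i' j'. dyadic_game i' j' |\<in>| opts p (dyadic_game i j) \<and>
     of_int (player_sign p) * (dyadic i' j' + dyadic k l) \<ge> 0"
proof -
  have "dyadic i j + dyadic k l = of_int (i + k * 2 ^ (j - l)) / 2 ^ j"
    using jl(2) by (simp add: dyadic_def field_simps flip: power_add)
  then have eq: "of_int (player_sign p) * (dyadic i j + dyadic k l) =
     of_int (player_sign p * (i + k * 2 ^ (j - l))) / 2 ^ j"
    by simp
  then have "player_sign p * (i + k * 2 ^ (j - l)) > 0"
    using pos by (simp add: zero_less_divide_iff flip: of_int_mult)
  then have "1 \<le> (of_int (player_sign p * (i + k * 2 ^ (j - l))) :: rat)"
    by (subst of_int_1_le_iff) simp
  then have ge: "1 / 2 ^ j \<le> of_int (player_sign p) * (dyadic i j + dyadic k l)"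
    unfolding eq by (rule divide_right_mono) simp
  have sq: "of_int (player_sign p) * of_int (player_sign p) = (1::rat)"
    by (cases p) auto
  show ?thesis
  proof (cases j)
    case 0
    have "dyadic (i - player_sign p) 0 = dyadic i j - of_int (player_sign p) / 2 ^ j"
      by (simp add: 0 dyadic_def)
    then show ?thesis
      using int 0 ge unfolding 0 opts_dyadic_game_0
      by (intro exI[of _ "i - player_sign p"] exI[of _ 0]) (cases p; auto simp: algebra_simps)
  next
    case (Suc j')
    then have i: "odd i" using jl by simp
    show ?thesis
      using ge sq unfolding Suc opts_dyadic_game_Suc[OF i]
      by (intro exI[of _ "(i - player_sign p) div 2"] exI[of _ j'])
        (simp add: dyadic_Suc_option[OF i] algebra_simps flip: add_divide_distrib)
  qed
qed

lemma dyadic_game_add_wins: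
  "(of_int (player_sign p) * (dyadic i j + dyadic k l) \<ge> 0 \<longrightarrow>
      \<not> wins_moving_first Normal (opponent p) (dyadic_game i j + dyadic_game k l)) \<and>
   (of_int (player_sign p) * (dyadic i j + dyadic k l) > 0 \<longrightarrow>
      wins_moving_first Normal p (dyadic_game i j + dyadic_game k l))"
proof (induction "size (dyadic_game i j + dyadic_game k l)" arbitrary: i j k l rule: less_induct)
  case less
  show ?case
  proof (intro conjI impI)
    assume nonneg: "of_int (player_sign p) * (dyadic i j + dyadic k l) \<ge> 0"
    show "\<not> wins_moving_first Normal (opponent p) (dyadic_game i j + dyadic_game k l)"
    proof
      assume "wins_moving_first Normal (opponent p) (dyadic_game i j + dyadic_game k l)"
      then obtain X where X: "X |\<in>| opts (opponent p) (dyadic_game i j + dyadic_game k l)"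
        "\<not> wins_moving_first Normal p X"
        using wins_normal_iff[of "opponent p"] by auto
      have "\<exists>i' j' k' l'. X = dyadic_game i' j' + dyadic_game k' l' \<and>
          of_int (player_sign p) * (dyadic i' j' + dyadic k' l') > 0"
        using X(1) unfolding opts_add_iff
      proof (elim disjE exE conjE)
        fix Y assume *: "Y |\<in>| opts (opponent p) (dyadic_game i j)" "X = Y + dyadic_game k l"
        show ?thesis
          using dyadic_game_option[OF *(1)] *(2) nonneg by (force simp: algebra_simps)
      next
        fix Y assume *: "Y |\<in>| opts (opponent p) (dyadic_game k l)" "X = dyadic_game i j + Y"
        show ?thesis
          using dyadic_game_option[OF *(1)] *(2) nonneg by (force simp: algebra_simps)
      qed
      then show False
        using less size_option_less[OF X(1)] X(2) by blast
    qed
  next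
    assume pos: "of_int (player_sign p) * (dyadic i j + dyadic k l) > 0"
    \<comment> \<open>The move is made in the first summand. The fact is used with the summands in
      either order, so that the larger denominator comes first or, for two integers, one that has
      the sign of \<open>p\<close>.\<close>
    have good: "wins_moving_first Normal p (dyadic_game i' j' + dyadic_game k' l')"
      if rep: "j' = 0 \<or> odd i'" "l' \<le> j'" "j' = 0 \<Longrightarrow> player_sign p * i' > 0"
        "dyadic_game i' j' + dyadic_game k' l' = dyadic_game i j + dyadic_game k l"
        "dyadic i' j' + dyadic k' l' = dyadic i j + dyadic k l" for i' j' k' l'
    proof -
      obtain i'' j'' where *: "dyadic_game i'' j'' |\<in>| opts p (dyadic_game i' j')"
        "of_int (player_sign p) * (dyadic i'' j'' + dyadic k' l') \<ge> 0"
        using dyadic_game_good_option[OF rep(1,2) _ rep(3)] pos rep(5) by metis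
      have "dyadic_game i'' j'' + dyadic_game k' l' |\<in>| opts p (dyadic_game i j + dyadic_game k l)"
        using * unfolding rep(4)[symmetric] opts_add_iff by blast
      then show ?thesis
        using less[OF size_option_less, of i'' j'' k' l'] * rep(4) wins_normalI by metis
    qed
    obtain i1 j1 where 1: "dyadic_game i j = dyadic_game i1 j1" "dyadic i j = dyadic i1 j1" "j1 = 0 \<or> odd i1"
      using dyadic_game_reduced by blast
    obtain k1 l1 where 2: "dyadic_game k l = dyadic_game k1 l1" "dyadic k l = dyadic k1 l1" "l1 = 0 \<or> odd k1"
      using dyadic_game_reduced by blast
    show "wins_moving_first Normal p (dyadic_game i j + dyadic_game k l)"
    proof (cases "j1 = 0 \<and> l1 = 0")
      case True
      then have "dyadic i j = of_int i1" "dyadic k l = of_int k1"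
        using 1 2 by (simp_all add: dyadic_def)
      then have "of_int (player_sign p * i1 + player_sign p * k1) > (0 :: rat)"
        using pos by (simp add: algebra_simps)
      then have "player_sign p * i1 > 0 \<or> player_sign p * k1 > 0"
        unfolding of_int_0_less_iff by linarith
      then show ?thesis
        using good[of j1 i1 l1 k1] good[of l1 k1 j1 i1] 1 2 True by (auto simp: add.commute)
    next
      case False
      then show ?thesis
        using good[of j1 i1 l1 k1] good[of l1 k1 j1 i1] 1 2
        by (cases "l1 \<le> j1") (auto simp: add.commute)
    qed
  qed
qed

text \<open>\<open>normal_equal\<close> replaces one summand at a time, the other one serving as the
  context \<open>X\<close>.\<close>

lemma normal_value_add_wins:
  assumes "has_normal_value G x" "has_normal_value H y" "of_int (player_sign p) * (x + y) > 0"
  shows "wins_moving_first Normal p (G + H)"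
proof -
  obtain i j k l where x: "x = dyadic i j" "normal_equal G (dyadic_game i j)"
    and y: "y = dyadic k l" "normal_equal H (dyadic_game k l)"
    using assms unfolding has_normal_value_def dyadic_def by blast
  have "o\<^sup>+ (G + H) = o\<^sup>+ (dyadic_game i j + H)"
    using x(2) unfolding normal_equal_def by blast
  also have "\<dots> = o\<^sup>+ (dyadic_game i j + dyadic_game k l)"
    using y(2) unfolding normal_equal_def by (metis add.commute)
  finally show ?thesis
    using dyadic_game_add_wins[of p i j k l] assms(3) x y
    by (cases p) (auto simp: outcome_def split: if_splits)
qed

lemma normal_value_wins:
  assumes "has_normal_value G x" "of_int (player_sign p) * x > 0"
  shows "wins_moving_first Normal p G"
proof -
  have "has_normal_value 0 0"
    unfolding has_normal_value_def
    by (intro exI[of _ 0]) (auto simp: normal_equal_def int_game_def)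
  from normal_value_add_wins[OF assms(1) this, of p] show ?thesis
    using assms(2) by simp
qed

section \<open>Cutting edges\<close>

lemma opts_game_of_iff:
  "X |\<in>| opts p (game_of H) \<longleftrightarrow>
     (\<exists>e. e \<in># edges H \<and> may_cut p (colour e) \<and> X = game_of (cut e H))"
proof -
  have "opts p (game_of H) = (\<lambda>e. game_of (cut e H)) |`| cuttable p H"
    by (cases p) (subst game_of.simps; simp)+
  then show ?thesis
    by (auto simp: cuttable_iff)
qed

lemma game_of_no_edges: "edges H = {#} \<Longrightarrow> game_of H = 0"
proof -
  assume "edges H = {#}"
  then have "opts p (game_of H) = {||}" for p
    using opts_game_of_iff[of _ p H] by auto
  from this[of Left] this[of Right] show ?thesis
    by (cases "game_of H") (simp add: zero_game_def)
qed

definition grounded_edges :: "'v set \<Rightarrow> 'v edge multiset \<Rightarrow> 'v edge multiset" where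
  "grounded_edges S E = {# e \<in># E. end1 e \<in> grounded_vertices S E #}"

lemma in_grounded_edges_iff:
  "e \<in># grounded_edges S E \<longleftrightarrow> e \<in># E \<and> end1 e \<in> grounded_vertices S E"
  unfolding grounded_edges_def by (simp del: filter_diff_mset)

lemma cut_simps [simp]:
  "ground (cut e H) = ground H"
  "edges (cut e H) = grounded_edges (ground H) (edges H - {#e#})"
  by (simp_all add: cut_def discard_ungrounded_def grounded_edges_def)

lemma hackenbush_position_iff:
  "hackenbush_position H \<longleftrightarrow> finite (ground H) \<and> grounded_edges (ground H) (edges H) = edges H"
  unfolding hackenbush_position_def discard_ungrounded_def grounded_edges_def
  by (cases H) auto

lemma grounded_vertices_mono:
  "set_mset E \<subseteq> set_mset F \<Longrightarrow> grounded_vertices S E \<subseteq> grounded_vertices S F"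
  unfolding grounded_vertices_def by (intro Image_mono rtrancl_mono) (auto simp: adjacency_def)

lemma ground_subset_grounded_vertices: "S \<subseteq> grounded_vertices S E"
  by (auto simp: grounded_vertices_def)

lemma grounded_vertices_step:
  assumes "u \<in> grounded_vertices S E" "(u, v) \<in> adjacency E"
  shows "v \<in> grounded_vertices S E"
  using assms unfolding grounded_vertices_def
  by (meson Image_iff rtrancl.rtrancl_into_rtrancl)

lemma adjacency_edge:
  "e \<in># E \<Longrightarrow> (end1 e, end2 e) \<in> adjacency E" "e \<in># E \<Longrightarrow> (end2 e, end1 e) \<in> adjacency E"
  by (cases e; auto simp: adjacency_def)+

lemma grounded_vertices_ends_iff:
  "e \<in># E \<Longrightarrow> end1 e \<in> grounded_vertices S E \<longleftrightarrow> end2 e \<in> grounded_vertices S E"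
  using adjacency_edge grounded_vertices_step by metis

lemma grounded_vertices_induct [consumes 1, case_names ground step]:
  assumes "v \<in> grounded_vertices S E"
    and "\<And>v. v \<in> S \<Longrightarrow> P v"
    and "\<And>e u v. u \<in> grounded_vertices S E \<Longrightarrow> P u \<Longrightarrow> e \<in># E \<Longrightarrow>
       (u = end1 e \<and> v = end2 e) \<or> (u = end2 e \<and> v = end1 e) \<Longrightarrow> P v"
  shows "P v"
proof -
  obtain s where s: "s \<in> S" "(s, v) \<in> (adjacency E)\<^sup>*"
    using assms(1) by (auto simp: grounded_vertices_def)
  have "v \<in> grounded_vertices S E \<and> P v"
    using s(2)
  proof (induction rule: rtrancl_induct)
    case base
    then show ?case
      using s assms(2) ground_subset_grounded_vertices by fast
  next
    case (step u w)
    then obtain c where "Edge u w c \<in># E \<or> Edge w u c \<in># E"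
      by (auto simp: adjacency_def)
    then have "P w"
      using assms(3)[of u "Edge u w c" w] assms(3)[of u "Edge w u c" w] step by auto
    then show ?case
      using step grounded_vertices_step by fast
  qed
  then show ?thesis ..
qed

text \<open>A path from the ground runs through grounded edges only, so it survives in
  \<open>F\<close>.\<close>

lemma grounded_vertices_grounded_edges:
  assumes "set_mset (grounded_edges S E) \<subseteq> set_mset F" "set_mset F \<subseteq> set_mset E"
  shows "grounded_vertices S F = grounded_vertices S E"
proof
  show "grounded_vertices S F \<subseteq> grounded_vertices S E"
    by (rule grounded_vertices_mono) fact
  show "grounded_vertices S E \<subseteq> grounded_vertices S F"
  proof
    fix v
    assume "v \<in> grounded_vertices S E"
    then show "v \<in> grounded_vertices S F"
    proof (induction rule: grounded_vertices_induct)
      case (ground v)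
      then show ?case using ground_subset_grounded_vertices by fast
    next
      case (step e u v)
      then have "e \<in># F"
        using assms(1) grounded_vertices_step[OF step.hyps(1)] adjacency_edge[OF step.hyps(2)]
        unfolding grounded_edges_def by auto
      then show ?case
        using step.IH step.hyps(3) adjacency_edge grounded_vertices_step by metis
    qed
  qed
qed

lemma grounded_edges_idem: "grounded_edges S (grounded_edges S E) = grounded_edges S E"
  using grounded_vertices_grounded_edges[of S E "grounded_edges S E"]
  unfolding grounded_edges_def by (simp add: filter_filter_mset)

text \<open>What is ungrounded stays so after further removals, so discarding it early changes
  nothing. This is what makes cuts commute.\<close>

lemma grounded_edges_diff:
  "grounded_edges S (grounded_edges S E - F) = grounded_edges S (E - F)"
proof -
  let ?P = "\<lambda>e. end1 e \<in> grounded_vertices S E"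
  have eq: "grounded_edges S E - F = filter_mset ?P (E - F)"
    unfolding grounded_edges_def by (auto simp: multiset_eq_iff)
  have "grounded_vertices S (E - F) \<subseteq> grounded_vertices S E"
    by (rule grounded_vertices_mono) (auto dest: in_diffD)
  then have "set_mset (grounded_edges S (E - F)) \<subseteq> set_mset (filter_mset ?P (E - F))"
    by (auto simp: grounded_edges_def simp del: filter_diff_mset)
  then have vert: "grounded_vertices S (filter_mset ?P (E - F)) = grounded_vertices S (E - F)"
    by (intro grounded_vertices_grounded_edges) (auto simp del: filter_diff_mset)
  have "filter_mset (\<lambda>e. end1 e \<in> grounded_vertices S (E - F)) (filter_mset ?P M) =
      filter_mset (\<lambda>e. end1 e \<in> grounded_vertices S (E - F)) M" for M
    unfolding filter_filter_mset using \<open>grounded_vertices S (E - F) \<subseteq> _\<close>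
    by (intro filter_mset_cong) auto
  then show ?thesis
    unfolding eq unfolding grounded_edges_def vert by blast
qed

lemma cut_commute: "cut e (cut f H) = cut f (cut e H)"
proof -
  have "edges (cut e (cut f H)) = grounded_edges (ground H) (edges H - {#f#} - {#e#})" for e f
    by (simp add: grounded_edges_diff)
  then have "edges (cut e (cut f H)) = edges (cut f (cut e H))"
    by (simp add: diff_diff_add_mset add_mset_commute)
  then show ?thesis
    by (simp add: cut_def discard_ungrounded_def)
qed

lemma hackenbush_position_cut: "hackenbush_position H \<Longrightarrow> hackenbush_position (cut e H)"
  by (simp add: hackenbush_position_iff grounded_edges_idem)

lemma cut_nonmember:
  assumes "hackenbush_position H" "e \<notin># edges H"
  shows "cut e H = H"
  using assms by (simp add: cut_def hackenbush_position_def diff_single_trivial)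

text \<open>On a path from the ground, whichever of the two edges comes first is reached without the
  other. Formally, if both fell, then no step of a path could use either edge, so every vertex would
  stay grounded without them, and \<open>e\<close> would survive after all.\<close>

lemma edge_survives_one_cut:
  assumes "hackenbush_position H" "e \<in># edges H" "f \<in># edges H" "e \<noteq> f"
  shows "e \<in># edges (cut f H) \<or> f \<in># edges (cut e H)"
proof (rule ccontr)
  assume not: "\<not> ?thesis"
  define S where "S = ground H"
  define E where "E = edges H"
  have pos: "grounded_edges S E = E"
    using assms(1) by (simp add: hackenbush_position_iff S_def E_def)
  have reach: "v \<in> grounded_vertices S (E - {#e#}) \<and> v \<in> grounded_vertices S (E - {#f#})"
    if "v \<in> grounded_vertices S E" for v
    using that
  proof (induction rule: grounded_vertices_induct)
    case (ground v)
    then show ?case using ground_subset_grounded_vertices by fast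
  next
    case (step d u v)
    have in_cut: "d \<in># grounded_edges S (E - {#x#})" if "d \<noteq> x" "x \<in> {e, f}" for x
    proof -
      have d: "d \<in># E - {#x#}"
        using step.hyps(2) that(1) by (simp add: in_diff_count)
      moreover have "end1 d \<in> grounded_vertices S (E - {#x#})"
        using step.IH step.hyps(3) that(2) grounded_vertices_ends_iff[OF d] by blast
      ultimately show ?thesis
        unfolding in_grounded_edges_iff ..
    qed
    then have "d \<noteq> e" "d \<noteq> f"
      using not assms(4) by (auto simp: S_def E_def)
    then have "d \<in># E - {#e#}" "d \<in># E - {#f#}"
      using step.hyps(2) by (simp_all add: in_diff_count)
    then show ?case
      using step.IH step.hyps(3) grounded_vertices_step adjacency_edge by metis
  qed
  have "end1 e \<in> grounded_vertices S E"
    using assms(2) pos in_grounded_edges_iff E_def by metis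
  then have "e \<in># edges (cut f H)"
    using reach assms(2,4) by (simp add: in_grounded_edges_iff S_def E_def in_diff_count)
  then show False using not by blast
qed

section \<open>Red--blue positions\<close>

definition red_blue_position :: "'v hackenbush \<Rightarrow> bool" where
  "red_blue_position H \<longleftrightarrow> hackenbush_position H \<and> red_blue H"

lemma in_edges_cutD: "e \<in># edges (cut f H) \<Longrightarrow> e \<in># edges H"
  by (auto simp: in_grounded_edges_iff dest: in_diffD)

lemma red_blue_position_cut: "red_blue_position H \<Longrightarrow> red_blue_position (cut e H)"
  unfolding red_blue_position_def
  by (auto simp: hackenbush_position_cut red_blue_def simp del: cut_simps dest: in_edges_cutD)

lemma may_cut_opponent:
  "red_blue H \<Longrightarrow> e \<in># edges H \<Longrightarrow> may_cut p (colour e) \<Longrightarrow> \<not> may_cut (opponent p) (colour e)"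
  by (cases p; cases "colour e") (auto simp: red_blue_def)

text \<open>The mirrored strategy: the owner of \<open>e\<close> answers in \<open>H\<close> as in \<open>cut e H\<close>; if the opponent's
  move disconnects something only in \<open>cut e H\<close>, cutting \<open>e\<close> restores equality.\<close>
lemma own_cut_not_profitable:
  assumes "red_blue_position H" "e \<in># edges H" "may_cut p (colour e)"
  shows "(\<not> wins_moving_first Normal (opponent p) (game_of (cut e H) + K) \<longrightarrow>
            \<not> wins_moving_first Normal (opponent p) (game_of H + K)) \<and>
         (wins_moving_first Normal p (game_of (cut e H) + K) \<longrightarrow>
            wins_moving_first Normal p (game_of H + K))"
  using assms
proof (induction "size (game_of H + K)" arbitrary: H K rule: less_induct)
  case less
  note H = \<open>red_blue_position H\<close> and e = \<open>e \<in># edges H\<close> \<open>may_cut p (colour e)\<close>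
  have pos: "hackenbush_position H" "red_blue H"
    using H by (simp_all add: red_blue_position_def)
  have IH_H: "(\<not> wins_moving_first Normal (opponent p) (game_of (cut e (cut f H)) + K) \<longrightarrow>
            \<not> wins_moving_first Normal (opponent p) (game_of (cut f H) + K)) \<and>
         (wins_moving_first Normal p (game_of (cut e (cut f H)) + K) \<longrightarrow>
            wins_moving_first Normal p (game_of (cut f H) + K))"
    if f: "f \<in># edges H" "may_cut r (colour f)" for f r
  proof (cases "e \<in># edges (cut f H)")
    case True
    have "game_of (cut f H) + K |\<in>| opts r (game_of H + K)"
      using f by (auto simp: opts_add_iff opts_game_of_iff)
    then show ?thesis
      using less(1)[OF _ red_blue_position_cut[OF H] True e(2)] size_option_less by blast
  next
    \<comment> \<open>Here \<open>e\<close> has fallen with \<open>f\<close>, and both sides speak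
      of the same position.\<close>
    case False
    then show ?thesis
      using cut_nonmember hackenbush_position_cut pos(1) by metis
  qed
  have IH_K: "(\<not> wins_moving_first Normal (opponent p) (game_of (cut e H) + K') \<longrightarrow>
            \<not> wins_moving_first Normal (opponent p) (game_of H + K')) \<and>
         (wins_moving_first Normal p (game_of (cut e H) + K') \<longrightarrow>
            wins_moving_first Normal p (game_of H + K'))"
    if "K' |\<in>| opts r K" for K' r
  proof -
    have "game_of H + K' |\<in>| opts r (game_of H + K)"
      using that by (auto simp: opts_add_iff)
    then show ?thesis
      using less(1)[OF _ H e] size_option_less by blast
  qed
  show ?case
  proof (intro conjI impI)
    assume lose: "\<not> wins_moving_first Normal (opponent p) (game_of (cut e H) + K)"
    have "wins_moving_first Normal p X" if X: "X |\<in>| opts (opponent p) (game_of H + K)" for X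
      using X unfolding opts_add_iff
    proof (elim disjE exE conjE)
      fix Y assume "Y |\<in>| opts (opponent p) (game_of H)" and X: "X = Y + K"
      then obtain f where f: "f \<in># edges H" "may_cut (opponent p) (colour f)" "Y = game_of (cut f H)"
        by (auto simp: opts_game_of_iff)
      show ?thesis
      proof (cases "f \<in># edges (cut e H)")
        case True
        have "game_of (cut f (cut e H)) + K |\<in>| opts (opponent p) (game_of (cut e H) + K)"
          using True f by (auto simp: opts_add_iff opts_game_of_iff simp del: cut_simps)
        then have "wins_moving_first Normal p (game_of (cut f (cut e H)) + K)"
          using wins_normal_after_loser_moves[OF lose] by simp
        then show ?thesis
          using IH_H[OF f(1,2)] f X by (simp add: cut_commute)
      next
        case False
        have "e \<noteq> f"
          using may_cut_opponent[OF pos(2)] e f by auto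
        then have "e \<in># edges (cut f H)"
          using edge_survives_one_cut[OF pos(1) e(1) f(1)] False by simp
        moreover have "cut e (cut f H) = cut e H"
          using cut_nonmember[OF hackenbush_position_cut[OF pos(1)] False] cut_commute by metis
        ultimately have "game_of (cut e H) + K |\<in>| opts p (X)"
          using e(2) X f by (auto simp: opts_add_iff opts_game_of_iff simp del: cut_simps)
        then show ?thesis
          using lose wins_normalI by blast
      qed
    next
      fix K' assume K': "K' |\<in>| opts (opponent p) K" and X: "X = game_of H + K'"
      then have "game_of (cut e H) + K' |\<in>| opts (opponent p) (game_of (cut e H) + K)"
        by (auto simp: opts_add_iff)
      then show ?thesis
        using IH_K[OF K'] X wins_normal_after_loser_moves[OF lose] by simp
    qed
    then show "\<not> wins_moving_first Normal (opponent p) (game_of H + K)"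
      using wins_normal_iff[of "opponent p"] by auto
  next
    assume "wins_moving_first Normal p (game_of (cut e H) + K)"
    then obtain X where X: "X |\<in>| opts p (game_of (cut e H) + K)"
      "\<not> wins_moving_first Normal (opponent p) X"
      using wins_normal_iff by blast
    show "wins_moving_first Normal p (game_of H + K)"
      using X(1) unfolding opts_add_iff
    proof (elim disjE exE conjE)
      fix Y assume "Y |\<in>| opts p (game_of (cut e H))" and XY: "X = Y + K"
      then obtain g where g: "g \<in># edges (cut e H)" "may_cut p (colour g)" "Y = game_of (cut g (cut e H))"
        by (auto simp: opts_game_of_iff simp del: cut_simps)
      have gH: "g \<in># edges H"
        using g(1) by (rule in_edges_cutD)
      have "\<not> wins_moving_first Normal (opponent p) (game_of (cut g H) + K)"
        using IH_H[OF gH g(2)] X(2) XY g(3) by (simp add: cut_commute)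
      moreover have "game_of (cut g H) + K |\<in>| opts p (game_of H + K)"
        using gH g(2) by (auto simp: opts_add_iff opts_game_of_iff)
      ultimately show ?thesis
        using wins_normalI by blast
    next
      fix K' assume K': "K' |\<in>| opts p K" and XY: "X = game_of (cut e H) + K'"
      then have "game_of H + K' |\<in>| opts p (game_of H + K)"
        by (auto simp: opts_add_iff)
      then show ?thesis
        using IH_K[OF K'] XY X(2) wins_normalI by blast
    qed
  qed
qed

lemma red_blue_sum_not_both_win:
  assumes "red_blue_position B" "red_blue_position C"
    and "wins_moving_first Normal p (game_of B + game_of C)"
  shows "\<not> wins_moving_first Normal (opponent p) (game_of B + game_of C)"
proof -
  obtain X where X: "X |\<in>| opts p (game_of B + game_of C)" "\<not> wins_moving_first Normal (opponent p) X"
    using assms(3) wins_normal_iff by blast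
  \<comment> \<open>The vertex types are fresh variables, because the fact is used for both orders
    of two summands that may have different types.\<close>
  have *: "\<not> wins_moving_first Normal (opponent p) (game_of B + game_of C)"
    if asm: "red_blue_position B" "Y |\<in>| opts p (game_of B)"
      "\<not> wins_moving_first Normal (opponent p) (Y + game_of C)"
    for Y and B :: "'c hackenbush" and C :: "'d hackenbush"
  proof -
    obtain e where e: "e \<in># edges B" "may_cut p (colour e)" "Y = game_of (cut e B)"
      using asm(2) opts_game_of_iff by blast
    show ?thesis
      using own_cut_not_profitable[OF asm(1) e(1,2), of "game_of C"] asm(3) e(3) by simp
  qed
  show ?thesis
    using X(1) unfolding opts_add_iff
  proof (elim disjE exE conjE)
    fix Y assume "Y |\<in>| opts p (game_of B)" "X = Y + game_of C"
    then show ?thesis using *[OF assms(1)] X(2) by blast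
  next
    fix Y assume "Y |\<in>| opts p (game_of C)" "X = game_of B + Y"
    then show ?thesis using *[OF assms(2), of Y B] X(2) by (simp add: add.commute)
  qed
qed

lemma red_blue_not_both_win:
  assumes "red_blue_position B" "wins_moving_first Normal p (game_of B)"
  shows "\<not> wins_moving_first Normal (opponent p) (game_of B)"
proof -
  \<comment> \<open>An empty second summand reduces the claim to the one on sums.\<close>
  define C where "C = B\<lparr>ground := {}, edges := {#}\<rparr>"
  have C: "red_blue_position C" "game_of C = 0"
    by (auto simp: C_def red_blue_position_def hackenbush_position_iff red_blue_def
        grounded_edges_def game_of_no_edges)
  show ?thesis
    using red_blue_sum_not_both_win[OF assms(1) C(1)] assms(2) C(2) by simp
qed

section \<open>Moves in Generalized Sprigs and Stalks\<close>

definition plant :: "'v hackenbush \<Rightarrow> 'v \<Rightarrow> 'v sprig_vertex" where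
  "plant B v = (if v \<in> ground B then Top else Inner v)"

lemma edges_generalized_sprig:
  "edges (generalized_sprig B) = add_mset (Edge Root Top Green) (image_mset (map_edge (plant B)) (edges B))"
  "ground (generalized_sprig B) = {Root}"
  by (simp_all add: generalized_sprig_def plant_def[abs_def])

text \<open>\<open>plant\<close> merges the ground vertices of \<open>B\<close>, so a path in the
  Sprig may enter \<open>Top\<close> from one of them and leave from another. Lifted to
  \<open>B\<close>, the path simply restarts at the ground there.\<close>

lemma plant_grounded_iff:
  assumes "S = ground B"
  shows "plant B v \<in> grounded_vertices {Root} (add_mset (Edge Root Top Green) (image_mset (map_edge (plant B)) E))
     \<longleftrightarrow> v \<in> grounded_vertices S E" (is "_ \<in> grounded_vertices _ ?E \<longleftrightarrow> _")
proof
  have Top: "Top \<in> grounded_vertices {Root} ?E"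
    using grounded_vertices_step[of Root "{Root}" ?E Top] ground_subset_grounded_vertices[of "{Root}" ?E]
      adjacency_edge(1)[of "Edge Root Top Green" ?E] by auto
  assume "v \<in> grounded_vertices S E"
  then show "plant B v \<in> grounded_vertices {Root} ?E"
  proof (induction rule: grounded_vertices_induct)
    case (ground v)
    then show ?case
      using Top assms by (simp add: plant_def[of B v])
  next
    case (step e u v)
    have "map_edge (plant B) e \<in># ?E" using step.hyps(2) by simp
    from adjacency_edge[OF this] show ?case
      using step.IH step.hyps(3) grounded_vertices_step by (auto simp: edge.map_sel)
  qed
next
  have lift: "\<forall>v. w = plant B v \<longrightarrow> v \<in> grounded_vertices S E"
    if "w \<in> grounded_vertices {Root} ?E" for w
    using that
  proof (induction rule: grounded_vertices_induct)
    case (ground w)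
    then show ?case by (auto simp: plant_def)
  next
    case (step e u w)
    have same: "x \<in> grounded_vertices S E" if "plant B x = plant B y" "y \<in> grounded_vertices S E" for x y
      using that ground_subset_grounded_vertices[of S E] assms by (auto simp: plant_def split: if_splits)
    show ?case
    proof (cases "e = Edge Root Top Green")
      case True
      then show ?thesis
        using step.hyps(3) ground_subset_grounded_vertices[of S E] assms
        by (auto simp: plant_def split: if_splits)
    next
      case False
      then obtain d where d: "d \<in># E" "e = map_edge (plant B) d"
        using step.hyps(2) by auto
      have "(end1 d \<in> grounded_vertices S E \<and> w = plant B (end2 d)) \<or>
            (end2 d \<in> grounded_vertices S E \<and> w = plant B (end1 d))"
        using step.IH step.hyps(3) d(2) by (auto simp: edge.map_sel)
      then show ?thesis
        using same grounded_vertices_step adjacency_edge[OF d(1)] by metis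
    qed
  qed
  assume "plant B v \<in> grounded_vertices {Root} ?E"
  then show "v \<in> grounded_vertices S E"
    using lift by blast
qed

text \<open>\<open>plant\<close> may send distinct edges to equal ones, for instance when they leave
  different ground vertices. Multiset images keep multiplicities, so exactly one copy is
  removed.\<close>

lemma cut_blossom_edge:
  assumes "e \<in># edges B"
  shows "cut (map_edge (plant B) e) (generalized_sprig B) = generalized_sprig (cut e B)"
proof -
  let ?g = "Edge Root Top Green"
  have plant: "plant (cut e B) = plant B"
    by (simp add: plant_def fun_eq_iff)
  have ne: "?g \<noteq> map_edge (plant B) e"
    by (cases e) (auto simp: plant_def)
  then have "edges (generalized_sprig B) - {#map_edge (plant B) e#} =
      add_mset ?g (image_mset (map_edge (plant B)) (edges B - {#e#}))"
    using assms by (simp add: edges_generalized_sprig image_mset_Diff)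
  moreover have "grounded_edges {Root} (add_mset ?g (image_mset (map_edge (plant B)) F)) =
      add_mset ?g (image_mset (map_edge (plant B)) (grounded_edges (ground B) F))" for F
    using ground_subset_grounded_vertices[of "{Root}"]
    by (simp add: grounded_edges_def filter_mset_image_mset edge.map_sel plant_grounded_iff)
  ultimately have "edges (cut (map_edge (plant B) e) (generalized_sprig B)) =
      edges (generalized_sprig (cut e B))"
    by (simp add: edges_generalized_sprig plant)
  then show ?thesis
    by (simp add: cut_def discard_ungrounded_def generalized_sprig_def)
qed

lemma cut_sprig_stem: "edges (cut (Edge Root Top Green) (generalized_sprig B)) = {#}"
proof -
  have "v = Root" if "v \<in> grounded_vertices {Root} (image_mset (map_edge (plant B)) (edges B))" for v
    using that
  proof (induction rule: grounded_vertices_induct)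
    case (step e u v)
    then show ?case by (auto simp: edge.map_sel plant_def split: if_splits)
  qed simp
  then show ?thesis
    by (auto simp: edges_generalized_sprig grounded_edges_def filter_mset_eq_conv edge.map_sel plant_def
        split: if_splits)
qed

lemma opts_generalized_sprig_iff:
  "X |\<in>| opts p (game_of (generalized_sprig B)) \<longleftrightarrow>
     X = 0 \<or> (\<exists>e. e \<in># edges B \<and> may_cut p (colour e) \<and> X = game_of (generalized_sprig (cut e B)))"
proof -
  have stem: "game_of (cut (Edge Root Top Green) (generalized_sprig B)) = 0"
    by (rule game_of_no_edges) (rule cut_sprig_stem)
  have "may_cut p Green" by (cases p) auto
  then have "X |\<in>| opts p (game_of (generalized_sprig B)) \<longleftrightarrow> X = 0 \<or>
      (\<exists>e. e \<in># edges B \<and> may_cut p (colour (map_edge (plant B) e)) \<and>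
         X = game_of (cut (map_edge (plant B) e) (generalized_sprig B)))"
    unfolding opts_game_of_iff using stem by (auto simp: edges_generalized_sprig simp del: cut_simps)
  then show ?thesis
    using cut_blossom_edge by (metis edge.map_sel(3))
qed

lemma cut_stalk:
  assumes "i < h"
  shows "cut (Edge i (Suc i) Green) (stalk h) = stalk i"
proof -
  let ?e = "\<lambda>i. Edge i (Suc i) Green"
  have E: "edges (stalk h) = image_mset ?e (mset_set {..<h})" for h
    by (simp add: stalk_def lessThan_atLeast0 flip: mset_upt)
  have diff: "edges (stalk h) - {#?e i#} = image_mset ?e (mset_set ({..<h} - {i}))"
    using assms unfolding E by (subst mset_set_Diff) (auto simp: image_mset_Diff)
  let ?V = "grounded_vertices {0} (image_mset ?e (mset_set ({..<h} - {i})))"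
  have sub: "v \<le> i" if "v \<in> ?V" for v
    using that
  proof (induction rule: grounded_vertices_induct)
    case (step e u v)
    then obtain j where "j \<noteq> i" "e = ?e j" by auto
    then show ?case using step.IH step.hyps(3) by auto
  qed simp
  have sup: "v \<in> ?V" if "v \<le> i" for v
    using that
  proof (induction v)
    case 0
    then show ?case using ground_subset_grounded_vertices[of "{0}"] by auto
  next
    case (Suc v)
    have "?e v \<in># image_mset ?e (mset_set ({..<h} - {i}))"
      using Suc(2) assms by (auto intro!: imageI)
    from adjacency_edge(1)[OF this] show ?case
      using Suc grounded_vertices_step by simp
  qed
  have "{j \<in> {..<h} - {i}. j \<in> ?V} = {..<i}"
  proof (intro set_eqI iffI)
    fix j
    assume "j \<in> {j \<in> {..<h} - {i}. j \<in> ?V}"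
    then show "j \<in> {..<i}" using sub[of j] by simp
  next
    fix j
    assume "j \<in> {..<i}"
    then show "j \<in> {j \<in> {..<h} - {i}. j \<in> ?V}" using sup[of j] assms by simp
  qed
  then have "grounded_edges {0} (edges (stalk h) - {#?e i#}) = edges (stalk i)"
    unfolding diff by (simp add: grounded_edges_def filter_mset_image_mset E filter_mset_mset_set)
  then show ?thesis
    by (simp add: cut_def discard_ungrounded_def grounded_edges_def stalk_def)
qed

lemma opts_stalk_iff:
  "X |\<in>| opts p (game_of (stalk h)) \<longleftrightarrow> (\<exists>i<h. X = game_of (stalk i))"
proof -
  have "may_cut p Green" by (cases p) auto
  moreover have "e \<in># edges (stalk h) \<longleftrightarrow> (\<exists>i<h. e = Edge i (Suc i) Green)" for e
    by (auto simp: stalk_def)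
  ultimately have "X |\<in>| opts p (game_of (stalk h)) \<longleftrightarrow>
      (\<exists>i<h. X = game_of (cut (Edge i (Suc i) Green) (stalk h)))"
    unfolding opts_game_of_iff by auto
  then show ?thesis
    using cut_stalk by metis
qed

section \<open>Nim\<close>

lemma comp_fun_commute_xor: "comp_fun_commute (Bit_Operations.xor :: nat \<Rightarrow> nat \<Rightarrow> nat)"
  by unfold_locales (simp add: fun_eq_iff xor.left_commute)

definition xor_mset :: "nat multiset \<Rightarrow> nat" where
  "xor_mset K = fold_mset Bit_Operations.xor 0 K"

lemma xor_mset_empty [simp]: "xor_mset {#} = 0"
  by (simp add: xor_mset_def)

lemma xor_mset_add [simp]: "xor_mset (add_mset h K) = Bit_Operations.xor h (xor_mset K)"
  unfolding xor_mset_def by (rule comp_fun_commute.fold_mset_add_mset[OF comp_fun_commute_xor])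

lemma nim_sum_eq_xor_mset: "nim_sum hs = xor_mset (mset hs)"
  by (induction hs) (simp_all add: nim_sum_def)

lemma xor_nat_cancel_left:
  fixes a b c :: nat
  shows "Bit_Operations.xor a b = Bit_Operations.xor a c \<longleftrightarrow> b = c"
  by (metis xor.assoc xor_self_eq xor.left_neutral)

lemma xor_nat_div_2: "Bit_Operations.xor (a::nat) b div 2 = Bit_Operations.xor (a div 2) (b div 2)"
  using drop_bit_xor[of 1 a b] by (simp add: drop_bit_eq_div)

lemma xor_nat_less_2_iff: "b < 2 \<Longrightarrow> Bit_Operations.xor (a::nat) b < 2 \<longleftrightarrow> a < 2"
proof -
  have iff: "x < 2 \<longleftrightarrow> x div 2 = 0" for x :: nat by presburger
  show "b < 2 \<Longrightarrow> ?thesis"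
    using xor_nat_div_2[of a b] by (simp add: iff)
qed

lemma less_2_nat: "(a::nat) < 2 \<longleftrightarrow> a = 0 \<or> a = 1"
  by auto

lemma xor_mset_less_2: "\<forall>h \<in># K. h < 2 \<Longrightarrow> xor_mset K < 2"
  by (induction K) (auto simp: xor_nat_less_2_iff)

lemma xor_mset_div_2: "xor_mset K div 2 = xor_mset (image_mset (\<lambda>h. h div 2) K)"
  by (induction K) (simp_all add: xor_nat_div_2)

lemma xor_mset_odd: "odd (xor_mset K) \<Longrightarrow> \<exists>h \<in># K. odd h"
  by (induction K) (auto simp: even_xor_iff)

text \<open>Halving all heaps descends to the leading bit of the nim-sum. There the nim-sum is 1,
  and an odd heap loses its last bit; a strict decrease of the halved heap lifts back to the heap
  itself.\<close>

lemma winning_nim_move: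
  "xor_mset K \<noteq> 0 \<Longrightarrow> \<exists>h \<in># K. Bit_Operations.xor h (xor_mset K) < h"
proof (induction "xor_mset K" arbitrary: K rule: less_induct)
  case less
  show ?case
  proof (cases "xor_mset K div 2 = 0")
    case True
    then have 1: "xor_mset K = 1"
      using less.prems by (auto simp: div_eq_0_iff less_2_nat)
    then obtain h where "h \<in># K" "odd h"
      using xor_mset_odd[of K] by auto
    then show ?thesis
      using 1 by (intro bexI[of _ h]) (auto simp: xor_Suc_0_eq elim!: oddE)
  next
    case False
    let ?K = "image_mset (\<lambda>h. h div 2) K"
    have "xor_mset ?K < xor_mset K"
      using less.prems unfolding xor_mset_div_2[symmetric] by simp
    moreover have "xor_mset ?K \<noteq> 0"
      using False by (simp add: xor_mset_div_2)
    ultimately obtain h where h: "h \<in># K" "Bit_Operations.xor (h div 2) (xor_mset ?K) < h div 2"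
      using less.hyps[of ?K] by auto
    then have "Bit_Operations.xor h (xor_mset K) div 2 < h div 2"
      unfolding xor_nat_div_2 xor_mset_div_2 by simp
    then have "Bit_Operations.xor h (xor_mset K) < h"
      by (metis div_le_mono leI leD)
    then show ?thesis using h(1) by blast
  qed
qed

text \<open>In misere Nim the winner is reversed once every heap has size at most 1.  Adding the heap 1 of
  the evil twin undoes the correction.\<close>
definition nim_value :: "convention \<Rightarrow> nat multiset \<Rightarrow> nat" where
  "nim_value c K =
     Bit_Operations.xor (xor_mset K) (if c = Misere \<and> (\<forall>h \<in># K. h < 2) then 1 else 0)"

lemma nim_value_add_1: "nim_value c (add_mset 1 K) = Bit_Operations.xor 1 (nim_value c K)"
  by (simp add: nim_value_def xor.assoc)

lemma nim_value_add_0: "nim_value c (add_mset 0 K) = nim_value c K"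
  by (simp add: nim_value_def)

text \<open>If the other heaps are all below 2 in misere play, a heap below 2 gives a value below 2
  and a larger heap a value of at least 2. Within each range the correction is constant and xor is
  injective.\<close>

lemma nim_value_move:
  assumes "h' < h"
  shows "nim_value c (add_mset h' K) \<noteq> nim_value c (add_mset h K)"
proof (cases "c = Misere \<and> (\<forall>h \<in># K. h < 2)")
  case True
  have x: "xor_mset K < 2" using True xor_mset_less_2 by blast
  have small: "Bit_Operations.xor (Bit_Operations.xor i (xor_mset K)) 1 < 2" if "i < 2" for i :: nat
    using that x by (simp only: xor_nat_less_2_iff one_less_numeral_iff semiring_norm)
  have large: "\<not> Bit_Operations.xor i (xor_mset K) < 2" if "\<not> i < 2" for i :: nat
    using that x by (simp only: xor_nat_less_2_iff not_False_eq_True)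
  have inj: "Bit_Operations.xor i (xor_mset K) = Bit_Operations.xor j (xor_mset K) \<longleftrightarrow> i = j" for i j :: nat
    by (metis xor.commute xor_nat_cancel_left)
  have val: "nim_value c (add_mset i K) =
     Bit_Operations.xor (Bit_Operations.xor i (xor_mset K)) (if i < 2 then 1 else 0)" for i
    using True by (simp add: nim_value_def)
  have inj1: "Bit_Operations.xor i 1 = Bit_Operations.xor j 1 \<longleftrightarrow> i = j" for i j :: nat
    by (metis xor.commute xor_nat_cancel_left)
  show ?thesis
  proof (cases "h < 2")
    case True
    then show ?thesis using assms by (simp add: val inj1 inj del: xor_one_eq One_nat_def)
  next
    case h: False
    show ?thesis
    proof (cases "h' < 2")
      case True
      then show ?thesis using small[OF True] large[OF h] h unfolding val by auto
    next
      case False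
      then show ?thesis using h assms by (simp add: val inj)
    qed
  qed
next
  case False
  then have "nim_value c (add_mset i K) = Bit_Operations.xor i (xor_mset K)" for i
    by (auto simp: nim_value_def)
  then show ?thesis
    using assms by (metis xor.commute xor_nat_cancel_left less_irrefl)
qed

lemma nim_value_ge_2:
  assumes "\<not> nim_value c K < 2"
  shows "\<exists>h \<in># K. 2 \<le> h"
proof (rule ccontr)
  assume "\<not> ?thesis"
  then have "xor_mset K < 2" by (intro xor_mset_less_2) auto
  then have "nim_value c K < 2"
    unfolding nim_value_def by (subst xor_nat_less_2_iff) auto
  with assms show False by blast
qed

text \<open>The first alternative is the end of misere play, where the player to move wins without a
  move. If heaps of size 1 remain and none is larger, removing any of them toggles the value.
  Otherwise the move of ordinary Nim works, up to the misere adjustment.\<close>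

lemma nim_value_winning_move:
  assumes "nim_value c K \<noteq> 0"
  shows "(c = Misere \<and> (\<forall>h \<in># K. h = 0)) \<or>
    (\<exists>h h' K'. K = add_mset h K' \<and> h' < h \<and> nim_value c (add_mset h' K') = 0)"
proof (cases "c = Misere \<and> (\<forall>h \<in># K. h < 2)")
  case True
  then have val: "nim_value c K = Bit_Operations.xor (xor_mset K) 1"
    by (simp add: nim_value_def)
  moreover have "xor_mset K = 0 \<or> xor_mset K = 1"
    using True xor_mset_less_2[of K] by (simp add: less_2_nat)
  ultimately have K: "xor_mset K = 0"
    using assms by (metis xor_self_eq)
  show ?thesis
  proof (cases "\<forall>h \<in># K. h = 0")
    case False
    then obtain h where h: "h \<in># K" "h \<noteq> 0" by blast
    have "h < 2" using True h(1) by blast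
    then have "h = 1" using h(2) by simp
    then obtain K' where K': "K = add_mset 1 K'" using h(1) by (metis multi_member_split)
    have "nim_value c (add_mset 0 K') = 0"
    proof -
      have "Bit_Operations.xor 1 (nim_value c K') = nim_value c K"
        by (simp only: K' nim_value_add_1)
      also have "\<dots> = Bit_Operations.xor 1 0"
        using val K by simp
      finally have "Bit_Operations.xor 1 (nim_value c K') = Bit_Operations.xor 1 0" .
      then show ?thesis
        unfolding nim_value_add_0 xor_nat_cancel_left .
    qed
    then show ?thesis
      using K' by (intro disjI2 exI[of _ 1] exI[of _ 0] exI[of _ K']) simp
  qed (use True in blast)
next
  case False
  then have K: "xor_mset K \<noteq> 0"
    using assms by (auto simp: nim_value_def split: if_splits)
  then obtain h K' where h: "K = add_mset h K'" "Bit_Operations.xor h (xor_mset K) < h"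
    using winning_nim_move by (metis multi_member_split)
  have eq: "Bit_Operations.xor h (xor_mset K) = xor_mset K'"
    unfolding h(1) by (simp flip: xor.assoc)
  show ?thesis
  proof (cases "c = Misere \<and> (\<forall>i \<in># add_mset (xor_mset K') K'. i < 2)")
    \<comment> \<open>The ordinary move would leave only heaps below 2, so the parity of the number
      of ones has to be reversed. The adjusted target is still below 2, hence below
      \<open>h\<close>.\<close>
    case small: True
    have "\<not> h < 2" using False small h(1) by auto
    moreover have "Bit_Operations.xor (xor_mset K') 1 < 2"
      using small by (subst xor_nat_less_2_iff) auto
    ultimately have "Bit_Operations.xor (xor_mset K') 1 < h" by linarith
    moreover have "nim_value c (add_mset (Bit_Operations.xor (xor_mset K') 1) K') = 0"
    proof -
      have "nim_value c (add_mset (Bit_Operations.xor (xor_mset K') 1) K') =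
        Bit_Operations.xor (Bit_Operations.xor (Bit_Operations.xor (xor_mset K') 1) (xor_mset K')) 1"
        using small \<open>Bit_Operations.xor (xor_mset K') 1 < 2\<close> unfolding nim_value_def xor_mset_add by simp
      also have "\<dots> = 0"
        by (metis xor.assoc xor.commute xor_self_eq xor.left_neutral)
      finally show ?thesis .
    qed
    ultimately show ?thesis using h(1) by blast
  next
    case big: False
    then have "nim_value c (add_mset (xor_mset K') K') = 0"
      unfolding nim_value_def by auto
    then show ?thesis
      using h(2) unfolding eq
      by (intro disjI2 exI[of _ h] exI[of _ "xor_mset K'"] exI[of _ K']) (simp add: h(1))
  qed
qed

section \<open>Positions of Generalized Sprigs and Stalks\<close>

definition position :: "'v hackenbush multiset \<Rightarrow> nat multiset \<Rightarrow> game" where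
  "position M N = (\<Sum>B\<in>#M. game_of (generalized_sprig B)) + (\<Sum>h\<in>#N. game_of (stalk h))"

definition blossom_move :: "player \<Rightarrow> 'v hackenbush \<Rightarrow> 'v hackenbush \<Rightarrow> bool" where
  "blossom_move p B B' \<longleftrightarrow> (\<exists>e. e \<in># edges B \<and> may_cut p (colour e) \<and> B' = cut e B)"

lemma blossom_move_game_of: "blossom_move p B B' \<Longrightarrow> game_of B' |\<in>| opts p (game_of B)"
  by (auto simp: blossom_move_def opts_game_of_iff)

lemma opts_game_of_blossom:
  assumes "X |\<in>| opts p (game_of B)"
  obtains B' where "blossom_move p B B'" "X = game_of B'"
  using assms unfolding blossom_move_def opts_game_of_iff by blast

lemma blossom_move_red_blue: "blossom_move p B B' \<Longrightarrow> red_blue_position B \<Longrightarrow> red_blue_position B'"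
  by (auto simp: blossom_move_def red_blue_position_cut)

lemma opts_sprig_iff:
  "X |\<in>| opts p (game_of (generalized_sprig B)) \<longleftrightarrow>
     X = 0 \<or> (\<exists>B'. blossom_move p B B' \<and> X = game_of (generalized_sprig B'))"
  unfolding opts_generalized_sprig_iff blossom_move_def by blast

lemma position_cut_stem: "position M N |\<in>| opts p (position (add_mset B M) N)"
proof -
  have "(0 :: game) |\<in>| opts p (game_of (generalized_sprig B))"
    by (simp add: opts_sprig_iff)
  then have "0 + position M N |\<in>| opts p (game_of (generalized_sprig B) + position M N)"
    unfolding opts_add_iff by blast
  then show ?thesis by (simp add: position_def add.assoc)
qed

lemma position_move_blossom:
  assumes "blossom_move p B B'"
  shows "position (add_mset B' M) N |\<in>| opts p (position (add_mset B M) N)"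
proof -
  have "game_of (generalized_sprig B') |\<in>| opts p (game_of (generalized_sprig B))"
    using assms unfolding opts_sprig_iff by blast
  then have "game_of (generalized_sprig B') + position M N
      |\<in>| opts p (game_of (generalized_sprig B) + position M N)"
    unfolding opts_add_iff by blast
  then show ?thesis by (simp add: position_def add.assoc)
qed

lemma position_move_stalk:
  assumes "h' < h"
  shows "position M (add_mset h' N) |\<in>| opts p (position M (add_mset h N))"
proof -
  have "game_of (stalk h') |\<in>| opts p (game_of (stalk h))"
    using assms unfolding opts_stalk_iff by blast
  then have "game_of (stalk h') + position M N |\<in>| opts p (game_of (stalk h) + position M N)"
    unfolding opts_add_iff by blast
  then show ?thesis by (simp add: position_def add.left_commute)
qed

lemma position_option_cases [consumes 1, case_names stem blossom stalk]:
  assumes "X |\<in>| opts p (position M N)"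
  obtains B M' where "M = add_mset B M'" "X = position M' N"
  | B B' M' where "M = add_mset B M'" "blossom_move p B B'" "X = position (add_mset B' M') N"
  | h h' N' where "N = add_mset h N'" "h' < h" "X = position M (add_mset h' N')"
proof -
  let ?S = "\<Sum>B\<in>#M. game_of (generalized_sprig B)" and ?T = "\<Sum>h\<in>#N. game_of (stalk h)"
  consider Y where "Y |\<in>| opts p ?S" "X = Y + ?T" | Y where "Y |\<in>| opts p ?T" "X = ?S + Y"
    using assms unfolding position_def opts_add_iff by blast
  then show thesis
  proof cases
    case 1
    then obtain B M' Z where *: "M = add_mset B M'" "Z |\<in>| opts p (game_of (generalized_sprig B))"
      "Y = Z + (\<Sum>B\<in>#M'. game_of (generalized_sprig B))"
      unfolding opts_sum_mset_iff by blast
    then consider "Z = 0" | B' where "blossom_move p B B'" "Z = game_of (generalized_sprig B')"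
      unfolding opts_sprig_iff by blast
    then show thesis
    proof cases
      case 1
      then show thesis
        using that(1)[OF *(1)] * \<open>X = Y + ?T\<close> by (simp add: position_def)
    next
      case 2
      then show thesis
        using that(2)[OF *(1) 2(1)] * \<open>X = Y + ?T\<close> by (simp add: position_def)
    qed
  next
    case 2
    then obtain h N' Z where *: "N = add_mset h N'" "Z |\<in>| opts p (game_of (stalk h))"
      "Y = Z + (\<Sum>h\<in>#N'. game_of (stalk h))"
      unfolding opts_sum_mset_iff by blast
    then obtain h' where "h' < h" "Z = game_of (stalk h')"
      unfolding opts_stalk_iff by blast
    then show thesis
      using that(3)[OF *(1)] * \<open>X = ?S + Y\<close> by (simp add: position_def)
  qed
qed

text \<open>For red--blue \<open>B\<close> of value \<open>x\<close>: \<open>x > 0\<close> if \<open>p = Left\<close>, and \<open>x < 0\<close> if \<open>p = Right\<close>.\<close>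
definition favours :: "player \<Rightarrow> 'v hackenbush \<Rightarrow> bool" where
  "favours p B \<longleftrightarrow> wins_moving_first Normal p (game_of B)"

definition neutral :: "'v hackenbush \<Rightarrow> bool" where
  "neutral B \<longleftrightarrow> \<not> favours Left B \<and> \<not> favours Right B"

lemma neutral_iff: "neutral B \<longleftrightarrow> \<not> favours p B \<and> \<not> favours (opponent p) B"
  by (cases p) (auto simp: neutral_def)

lemma favours_opponent: "red_blue_position B \<Longrightarrow> favours p B \<Longrightarrow> \<not> favours (opponent p) B"
  unfolding favours_def by (rule red_blue_not_both_win)

lemma favours_after_opponent_move:
  "\<not> favours (opponent p) B \<Longrightarrow> blossom_move (opponent p) B B' \<Longrightarrow> favours p B'"
  using wins_normal_after_loser_moves[OF _ blossom_move_game_of] unfolding favours_def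
  by (metis opponent_opponent)

lemma favours_good_move:
  assumes "favours p B"
  obtains B' where "blossom_move p B B'" "\<not> favours (opponent p) B'"
  using assms unfolding favours_def wins_normal_iff[of p] by (metis opts_game_of_blossom)

definition num_favouring :: "player \<Rightarrow> 'v hackenbush multiset \<Rightarrow> nat" where
  "num_favouring p M = size {#B \<in># M. favours p B#}"

lemma num_favouring_simps [simp]:
  "num_favouring p {#} = 0"
  "num_favouring p (add_mset B M) = (if favours p B then Suc (num_favouring p M) else num_favouring p M)"
  by (simp_all add: num_favouring_def)

lemma num_favouring_eq_0_iff: "num_favouring p M = 0 \<longleftrightarrow> (\<forall>B \<in># M. \<not> favours p B)"
  by (induction M) auto

lemma num_favouring_SucE:
  assumes "num_favouring p M = Suc k"
  obtains B M' where "M = add_mset B M'" "favours p B" "num_favouring p M' = k"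
proof -
  obtain B where B: "B \<in># M" "favours p B"
    using assms num_favouring_eq_0_iff[of p M] by auto
  then obtain M' where M: "M = add_mset B M'" by (metis multi_member_split)
  then show thesis using that[OF M B(2)] B(2) assms by simp
qed

text \<open>A Blossom of value 0 makes a Generalized Sprig of value \<open>*\<close>, which counts as a heap of size 1.\<close>
definition nimber :: "convention \<Rightarrow> 'v hackenbush multiset \<Rightarrow> nat multiset \<Rightarrow> nat" where
  "nimber c M N = nim_value c (image_mset (\<lambda>_. 1) {#B \<in># M. neutral B#} + N)"

lemma nimber_add_blossom [simp]:
  "nimber c (add_mset B M) N = (if neutral B then Bit_Operations.xor 1 (nimber c M N) else nimber c M N)"
  by (simp add: nimber_def nim_value_add_1 del: One_nat_def)

lemma nimber_move_stalk: "h' < h \<Longrightarrow> nimber c M (add_mset h' N) \<noteq> nimber c M (add_mset h N)"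
  unfolding nimber_def by (simp add: nim_value_move)

text \<open>For \<open>p = Left\<close> this says \<open>\<epsilon> > 0\<close> if favourable Blossoms exist, with \<open>C\<close> of value
  \<open>- min\<^sub>j y\<^sub>j\<close>; it also holds if there are only unfavourable ones.\<close>
definition dominated :: "player \<Rightarrow> 'v hackenbush multiset \<Rightarrow> bool" where
  "dominated p M \<longleftrightarrow> (\<exists>C \<in># M. favours (opponent p) C \<and>
     (\<forall>B \<in># M. favours p B \<longrightarrow> wins_moving_first Normal p (game_of B + game_of C)))"

text \<open>Used for a single pair \<open>*:(x) + *:(-y)\<close> with \<open>x \<ge> y\<close>: the winning answer to \<open>x > y\<close> may
  make the two values equal.\<close>
definition balanced :: "player \<Rightarrow> 'v hackenbush multiset \<Rightarrow> bool" where
  "balanced p M \<longleftrightarrow> num_favouring (opponent p) M = 1 \<and> (\<forall>B \<in># M. \<forall>C \<in># M. favours p B \<longrightarrow>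
     favours (opponent p) C \<longrightarrow> \<not> wins_moving_first Normal (opponent p) (game_of B + game_of C))"

text \<open>Sufficient conditions, under either convention, for the opponent of \<open>p\<close> to lose moving first
  (\<open>safe\<close>) and for \<open>p\<close> to win moving first (\<open>winning\<close>).  They do not decide every position in
  which both signs share a value, but such positions can be avoided by \<open>p\<close>.\<close>
definition safe :: "convention \<Rightarrow> player \<Rightarrow> 'v hackenbush multiset \<Rightarrow> nat multiset \<Rightarrow> bool" where
  "safe c p M N \<longleftrightarrow>
     (let m = num_favouring p M; n = num_favouring (opponent p) M; a = nimber c M N in
       n + 2 \<le> m \<or>
       (m = n + 1 \<and> (a \<noteq> 0 \<or> dominated p M)) \<or>
       (m = n \<and> a = 0 \<and> (n = 0 \<or> dominated p M \<or> balanced p M)))"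

definition winning :: "convention \<Rightarrow> player \<Rightarrow> 'v hackenbush multiset \<Rightarrow> nat multiset \<Rightarrow> bool" where
  "winning c p M N \<longleftrightarrow>
     (let m = num_favouring p M; n = num_favouring (opponent p) M; a = nimber c M N in
       n + 1 \<le> m \<or>
       (m = n \<and> (a \<noteq> 0 \<or> dominated p M)) \<or>
       (m + 1 = n \<and> a = 0 \<and> dominated p M))"

lemma xor_1_neq_0: "a = 0 \<Longrightarrow> Bit_Operations.xor 1 (a::nat) \<noteq> 0" "Bit_Operations.xor 1 a = (0::nat) \<Longrightarrow> a \<noteq> 0"
  by (cases "a = 0"; simp)+

section \<open>Moves of the opponent from safe positions\<close>

lemma sum_after_opponent_move:
  assumes "\<not> wins_moving_first Normal (opponent p) (game_of B + game_of C)"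
  shows "blossom_move (opponent p) B B' \<Longrightarrow> wins_moving_first Normal p (game_of B' + game_of C)"
    and "blossom_move (opponent p) C C' \<Longrightarrow> wins_moving_first Normal p (game_of B + game_of C')"
proof -
  have *: "wins_moving_first Normal p X" if "X |\<in>| opts (opponent p) (game_of B + game_of C)" for X
    using wins_normal_after_loser_moves[OF assms that] by simp
  show "blossom_move (opponent p) B B' \<Longrightarrow> wins_moving_first Normal p (game_of B' + game_of C)"
    and "blossom_move (opponent p) C C' \<Longrightarrow> wins_moving_first Normal p (game_of B + game_of C')"
    using * opts_add_iff blossom_move_game_of by blast+
qed

lemma dominated_no_favouring:
  assumes "num_favouring (opponent p) M \<noteq> 0" "num_favouring p M = 0"
  shows "dominated p M"
  using assms unfolding dominated_def num_favouring_eq_0_iff by blast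

lemma dominated_remove:
  assumes "dominated p (add_mset B M)" "red_blue_position B" "favours p B"
  shows "dominated p M"
  using assms favours_opponent[OF assms(2,3)] unfolding dominated_def by auto

text \<open>A move of the opponent in a sum that the opponent does not win turns a weak inequality
  into a strict one. If the move is made in the witness \<open>C\<close>, its successor becomes the
  witness; otherwise \<open>C\<close> remains the witness. Pairs not touched by the move must be
  strict beforehand.\<close>

lemma dominated_after_opponent_move:
  assumes rb: "\<forall>B \<in># add_mset X M. red_blue_position B"
    and move: "blossom_move (opponent p) X X'"
    and eq: "num_favouring p (add_mset X M) = num_favouring (opponent p) (add_mset X M)"
    and nz: "num_favouring (opponent p) (add_mset X M) \<noteq> 0"
    and dom: "dominated p (add_mset X M) \<or> balanced p (add_mset X M)"
    and X: "favours p X \<or> favours (opponent p) X \<and> favours (opponent p) X'"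
  shows "dominated p (add_mset X' M)"
proof -
  obtain C where C: "C \<in># add_mset X M" "favours (opponent p) C"
    "\<And>B. B \<in># add_mset X M \<Longrightarrow> favours p B \<Longrightarrow>
      \<not> wins_moving_first Normal (opponent p) (game_of B + game_of C)"
    and strict: "\<And>B. B \<in># M \<Longrightarrow> favours p B \<Longrightarrow> C \<noteq> X \<or> \<not> favours (opponent p) X \<Longrightarrow>
      wins_moving_first Normal p (game_of B + game_of C)"
    using dom
  proof
    assume "dominated p (add_mset X M)"
    then obtain C where "C \<in># add_mset X M" "favours (opponent p) C"
      "\<And>B. B \<in># add_mset X M \<Longrightarrow> favours p B \<Longrightarrow> wins_moving_first Normal p (game_of B + game_of C)"
      unfolding dominated_def by blast
    then show thesis
      using that rb red_blue_sum_not_both_win by (metis union_iff add_mset_add_single)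
  next
    \<comment> \<open>There is one Blossom of each sign and \<open>X\<close> is one of them. Hence
      no pair is left untouched, and the requirement \<open>strict\<close> is vacuous.\<close>
    assume bal: "balanced p (add_mset X M)"
    then have 1: "num_favouring (opponent p) (add_mset X M) = 1" by (simp add: balanced_def)
    show thesis
    proof (cases "favours p X")
      case True
      then have "\<forall>B \<in># M. \<not> favours p B"
        using eq 1 by (simp flip: num_favouring_eq_0_iff)
      moreover obtain C where "C \<in># add_mset X M" "favours (opponent p) C"
        using nz num_favouring_eq_0_iff by metis
      ultimately show thesis
        using that bal unfolding balanced_def by blast
    next
      case False
      then have "favours (opponent p) X" using X by blast
      moreover from this have "\<forall>B \<in># M. \<not> favours (opponent p) B"
        using 1 by (simp flip: num_favouring_eq_0_iff)
      ultimately show thesis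
        using that[of X] bal unfolding balanced_def by auto
    qed
  qed
  show ?thesis
  proof (cases "favours p X")
    case True
    then have nX: "\<not> favours (opponent p) X" using rb favours_opponent by auto
    then have "C \<in># M" using C(1,2) by auto
    moreover have "wins_moving_first Normal p (game_of X' + game_of C)"
      using sum_after_opponent_move(1)[OF C(3) move] True by simp
    ultimately show ?thesis
      using C(2) strict nX unfolding dominated_def by auto
  next
    case False
    then have X: "favours (opponent p) X" "favours (opponent p) X'" using X by auto
    have nX': "\<not> favours p X'"
      using favours_opponent[OF _ X(2)] blossom_move_red_blue[OF move] rb by auto
    show ?thesis
    proof (cases "C = X")
      case True
      have "wins_moving_first Normal p (game_of B + game_of X')" if "B \<in># M" "favours p B" for B
        using sum_after_opponent_move(2)[OF C(3) move[folded True]] that by simp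
      then show ?thesis
        using X(2) nX' unfolding dominated_def by auto
    next
      case False
      then have "C \<in># M" using C(1) by auto
      then show ?thesis
        using C(2) strict False nX' unfolding dominated_def by auto
    qed
  qed
qed

text \<open>The lead \<open>m - n\<close> drops only when the stem of a Blossom favouring
  \<open>p\<close> is cut, and then by one, because moves of the opponent in a Blossom never turn it
  towards the opponent. If \<open>m = n\<close> and \<open>a = 0\<close>, a move that keeps the lead
  either makes the Nim value nonzero or makes the order of values strict.\<close>

lemma winning_after_opponent_move:
  fixes M :: "'v hackenbush multiset"
  assumes rb: "\<forall>B \<in># M. red_blue_position B" and safe: "safe c p M N"
    and X: "X |\<in>| opts (opponent p) (position M N)"
  shows "\<exists>(M' :: 'v hackenbush multiset) N'. X = position M' N' \<and> (\<forall>B \<in># M'. red_blue_position B) \<and> winning c p M' N'"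
  using X
proof (cases rule: position_option_cases)
  case (stem B M')
  have nB: "favours p B \<Longrightarrow> \<not> favours (opponent p) B"
    using rb stem favours_opponent by auto
  have "winning c p M' N"
  proof (cases "favours p B")
    case True
    have rem: "dominated p M \<Longrightarrow> dominated p M'"
      using dominated_remove[of p B M'] True rb stem by auto
    have nn: "\<not> neutral B" using True by (simp add: neutral_iff[of B p])
    \<comment> \<open>If the pair was only \<open>balanced\<close>, the cut leaves a single Blossom,
      which favours the opponent, beside neutral ones; \<open>dominated\<close> then holds
      vacuously.\<close>
    show ?thesis
      using safe True nB[OF True] nn rem dominated_no_favouring[of p M'] stem(1)
      unfolding safe_def winning_def Let_def balanced_def by auto
  next
    case False
    show ?thesis
    proof (cases "favours (opponent p) B")
      case True
      then show ?thesis
        using safe False stem(1) unfolding safe_def winning_def Let_def by auto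
    next
      case nq: False
      then have "neutral B" using False by (simp add: neutral_iff[of B p])
      then show ?thesis
        using safe False nq stem(1) xor_1_neq_0 unfolding safe_def winning_def Let_def by auto
    qed
  qed
  then show ?thesis using rb stem by (intro exI[of _ M'] exI[of _ N]) auto
next
  case (blossom B B' M')
  have B': "red_blue_position B'"
    using blossom_move_red_blue[OF blossom(2)] rb blossom(1) by simp
  have B: "red_blue_position B" using rb blossom(1) by simp
  have "winning c p (add_mset B' M') N"
  proof (cases "favours (opponent p) B")
    case False
    then have f: "favours p B'" "\<not> favours (opponent p) B'" "\<not> neutral B'"
      using favours_after_opponent_move[OF _ blossom(2)] favours_opponent[OF B']
      by (auto simp: neutral_iff[of B' p])
    show ?thesis
    proof (cases "favours p B")
      case True
      then have "\<not> neutral B" by (simp add: neutral_iff[of B p])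
      moreover have "num_favouring p M = num_favouring (opponent p) M \<Longrightarrow>
          num_favouring (opponent p) M = 0 \<or> dominated p M \<or> balanced p M \<Longrightarrow> dominated p (add_mset B' M')"
        using dominated_after_opponent_move[of B M' p B'] rb blossom True by auto
      ultimately show ?thesis
        using safe False True f blossom(1) unfolding safe_def winning_def Let_def by auto
    next
      case nB: False
      then show ?thesis
        using safe False f blossom(1) unfolding safe_def winning_def Let_def by auto
    qed
  next
    case True
    then have nB: "\<not> favours p B" using favours_opponent[OF B] by auto
    show ?thesis
    proof (cases "favours (opponent p) B'")
      case B'q: True
      then have nB': "\<not> favours p B'" using favours_opponent[OF B'] by auto
      have "\<not> neutral B" "\<not> neutral B'"
        using True B'q by (auto simp: neutral_iff[of _ p])
      moreover have "num_favouring p M = num_favouring (opponent p) M \<Longrightarrow>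
          dominated p M \<or> balanced p M \<Longrightarrow> dominated p (add_mset B' M')"
        using dominated_after_opponent_move[of B M' p B'] rb blossom True B'q by auto
      ultimately show ?thesis
        using safe True nB B'q nB' blossom(1) unfolding safe_def winning_def Let_def by auto
    next
      case False
      then show ?thesis
        using safe True nB blossom(1) unfolding safe_def winning_def Let_def by auto
    qed
  qed
  then show ?thesis using rb blossom B' by (intro exI[of _ "add_mset B' M'"] exI[of _ N]) auto
next
  case (stalk h h' N')
  have "winning c p M (add_mset h' N')"
    using safe nimber_move_stalk[OF stalk(2), of c M N'] stalk(1)
    unfolding safe_def winning_def Let_def by auto
  then show ?thesis using rb stalk by (intro exI[of _ M] exI[of _ "add_mset h' N'"]) auto
qed

text \<open>In misere play a player without a move wins, so a loss of the player to move presupposes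
  a move. With no Sprig and no nonempty Stalk the Nim value would be the correction 1, which is not
  safe.\<close>

lemma safe_has_move:
  assumes "safe Misere p M N"
  shows "opts q (position M N) \<noteq> {||}"
proof (cases "M = {#}")
  case True
  then have nz: "nim_value Misere N = 0"
    using assms by (simp add: safe_def nimber_def)
  have "\<exists>h \<in># N. h \<noteq> 0"
  proof (rule ccontr)
    assume "\<not> ?thesis"
    then have all: "\<forall>h \<in># N. h = 0" by blast
    then have "xor_mset N = 0" by (induction N) auto
    moreover have "\<forall>h \<in># N. h < 2" using all by auto
    ultimately show False using nz by (simp add: nim_value_def)
  qed
  then obtain h where "h \<in># N" "0 < h" by auto
  then obtain N' where "N = add_mset h N'" by (metis multi_member_split)
  then show ?thesis
    using position_move_stalk[OF \<open>0 < h\<close>, of M N' q] by auto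
next
  case False
  then obtain B M' where "M = add_mset B M'" by (metis multiset_cases)
  then show ?thesis
    using position_cut_stem[of M' N q B] by auto
qed

section \<open>Safe moves from winning positions\<close>

definition has_safe_option :: "convention \<Rightarrow> player \<Rightarrow> 'v hackenbush multiset \<Rightarrow> nat multiset \<Rightarrow> bool" where
  "has_safe_option c p M N \<longleftrightarrow> (\<exists>(M' :: 'v hackenbush multiset) N'.
     position M' N' |\<in>| opts p (position M N) \<and> (\<forall>B \<in># M'. red_blue_position B) \<and> safe c p M' N')"

lemma has_safe_option_stem:
  assumes "M = add_mset B M'" "\<forall>B \<in># M. red_blue_position B" "safe c p M' N"
  shows "has_safe_option c p M N"
  using assms position_cut_stem unfolding has_safe_option_def
  by (intro exI[of _ M'] exI[of _ N]) auto

lemma has_safe_option_blossom: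
  assumes "M = add_mset B M'" "\<forall>B \<in># M. red_blue_position B" "blossom_move p B B'"
    "safe c p (add_mset B' M') N"
  shows "has_safe_option c p M N"
  using assms position_move_blossom[OF assms(3)] blossom_move_red_blue[OF assms(3)]
  unfolding has_safe_option_def
  by (intro exI[of _ "add_mset B' M'"] exI[of _ N]) auto

lemma has_safe_option_stalk:
  assumes "N = add_mset h N'" "h' < h" "\<forall>B \<in># M. red_blue_position B" "safe c p M (add_mset h' N')"
  shows "has_safe_option c p M N"
  using assms position_move_stalk[OF assms(2)] unfolding has_safe_option_def
  by (intro exI[of _ M] exI[of _ "add_mset h' N'"]) auto

text \<open>The Blossom removed is not the witness \<open>C\<close>, and the favourable ones are
  compared with the witness alone.\<close>

lemma dominated_remove_other:
  assumes "dominated p M" "num_favouring (opponent p) M \<ge> 2" "\<forall>B \<in># M. red_blue_position B"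
  obtains B M' where "M = add_mset B M'" "favours (opponent p) B" "dominated p M'"
proof -
  obtain C where C: "C \<in># M" "favours (opponent p) C"
    "\<forall>B \<in># M. favours p B \<longrightarrow> wins_moving_first Normal p (game_of B + game_of C)"
    using assms(1) unfolding dominated_def by blast
  then obtain M1 where M1: "M = add_mset C M1" by (metis multi_member_split)
  obtain k where "num_favouring (opponent p) M1 = Suc k"
    using assms(2) C(2) M1 by (cases "num_favouring (opponent p) M1") auto
  then obtain B M2 where B: "M1 = add_mset B M2" "favours (opponent p) B"
    by (rule num_favouring_SucE)
  have "dominated p (add_mset C M2)"
    using C M1 B unfolding dominated_def by auto
  then show thesis
    using that[of B "add_mset C M2"] M1 B by (simp add: add_mset_commute)
qed

text \<open>The alternatives are that the Blossom keeps its sign or lands on 0 and becomes a heap of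
  size 1. Both are safe wherever this move is used, so it need not be known which one
  occurs.\<close>

lemma good_blossom_move:
  assumes "M = add_mset B M'" "\<forall>B \<in># M. red_blue_position B" "favours p B"
  obtains B' where "blossom_move p B B'"
    "num_favouring (opponent p) (add_mset B' M') = num_favouring (opponent p) M"
    "(num_favouring p (add_mset B' M') = num_favouring p M \<and> nimber c (add_mset B' M') N = nimber c M N) \<or>
     (Suc (num_favouring p (add_mset B' M')) = num_favouring p M \<and>
        nimber c (add_mset B' M') N = Bit_Operations.xor 1 (nimber c M N))"
proof -
  have B: "\<not> favours (opponent p) B" "\<not> neutral B"
    using assms favours_opponent[of B p] by (auto simp: neutral_iff[of B p])
  obtain B' where B': "blossom_move p B B'" "\<not> favours (opponent p) B'"
    using favours_good_move[OF assms(3)] .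
  then have "neutral B' \<longleftrightarrow> \<not> favours p B'"
    by (simp add: neutral_iff[of B' p])
  then show thesis
    using that[OF B'(1)] B B'(2) assms(1,3) by (cases "favours p B'") auto
qed

lemma winning_has_safe_option:
  fixes M :: "'v hackenbush multiset"
  assumes rb: "\<forall>B \<in># M. red_blue_position B" and win: "winning c p M N"
  shows "(c = Misere \<and> opts p (position M N) = {||}) \<or> has_safe_option c p M N"
proof -
  define m where "m = num_favouring p M"
  define n where "n = num_favouring (opponent p) M"
  define a where "a = nimber c M N"
  \<comment> \<open>This fact and the next three describe four kinds of moves by their effect on
    \<open>m\<close>, \<open>n\<close> and \<open>a\<close>. Most cases below then only compare
    these numbers with \<open>safe\<close>.\<close>
  have cut_own: "\<exists>M' :: 'v hackenbush multiset. num_favouring p M' = k \<and> num_favouring (opponent p) M' = n \<and> nimber c M' N = a \<and>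
      (safe c p M' N \<longrightarrow> has_safe_option c p M N)" if mk: "m = Suc k" for k
  proof -
    obtain B M' where B: "M = add_mset B M'" "favours p B" "num_favouring p M' = k"
      using mk unfolding m_def by (rule num_favouring_SucE)
    then have "\<not> favours (opponent p) B" "\<not> neutral B"
      using rb favours_opponent[of B p] by (auto simp: neutral_iff[of B p])
    then show ?thesis
      using B has_safe_option_stem[OF B(1) rb, of c p N] unfolding n_def a_def
      by (intro exI[of _ M']) auto
  qed
  have cut_other: "\<exists>M' :: 'v hackenbush multiset. num_favouring p M' = m \<and> num_favouring (opponent p) M' = k \<and> nimber c M' N = a \<and>
      (safe c p M' N \<longrightarrow> has_safe_option c p M N)" if nk: "n = Suc k" for k
  proof -
    obtain B M' where B: "M = add_mset B M'" "favours (opponent p) B" "num_favouring (opponent p) M' = k"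
      using nk unfolding n_def by (rule num_favouring_SucE)
    then have "\<not> favours p B" "\<not> neutral B"
      using rb favours_opponent[of B p] by (auto simp: neutral_iff[of B p])
    then show ?thesis
      using B has_safe_option_stem[OF B(1) rb, of c p N] unfolding m_def a_def
      by (intro exI[of _ M']) auto
  qed
  have cut_other_dom: "\<exists>M' :: 'v hackenbush multiset. num_favouring p M' = m \<and> Suc (num_favouring (opponent p) M') = n \<and>
      nimber c M' N = a \<and> dominated p M' \<and> (safe c p M' N \<longrightarrow> has_safe_option c p M N)"
    if n2: "n \<ge> 2" and dom: "dominated p M"
  proof -
    obtain B M' where B: "M = add_mset B M'" "favours (opponent p) B" "dominated p M'"
      using dominated_remove_other[OF dom n2[unfolded n_def] rb] .
    then have "\<not> favours p B" "\<not> neutral B"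
      using rb favours_opponent[of B p] by (auto simp: neutral_iff[of B p])
    then show ?thesis
      using B has_safe_option_stem[OF B(1) rb, of c p N] unfolding m_def n_def a_def
      by (intro exI[of _ M']) auto
  qed
  have own_blossom: "\<exists>M' :: 'v hackenbush multiset. num_favouring (opponent p) M' = n \<and>
      ((num_favouring p M' = m \<and> nimber c M' N = a) \<or>
       (Suc (num_favouring p M') = m \<and> nimber c M' N = Bit_Operations.xor 1 a)) \<and>
      (safe c p M' N \<longrightarrow> has_safe_option c p M N)" if pos: "m > 0"
  proof -
    obtain k where "num_favouring p M = Suc k"
      using pos unfolding m_def by (cases "num_favouring p M") auto
    then obtain B M1 where B: "M = add_mset B M1" "favours p B"
      by (rule num_favouring_SucE)
    obtain B' where B': "blossom_move p B B'"
      "num_favouring (opponent p) (add_mset B' M1) = num_favouring (opponent p) M"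
      "(num_favouring p (add_mset B' M1) = num_favouring p M \<and> nimber c (add_mset B' M1) N = nimber c M N) \<or>
       (Suc (num_favouring p (add_mset B' M1)) = num_favouring p M \<and>
          nimber c (add_mset B' M1) N = Bit_Operations.xor 1 (nimber c M N))"
      using good_blossom_move[OF B(1) rb B(2)] .
    then show ?thesis
      using has_safe_option_blossom[OF B(1) rb B'(1), of c N] unfolding m_def n_def a_def
      by (intro exI[of _ "add_mset B' M1"]) blast
  qed
  consider "n + 1 \<le> m" "n \<ge> 1" | "n = 0" "m \<ge> 3" | "n = 0" "m = 2" | "n = 0" "m = 1"
    | "m = n" "a \<noteq> 0" "n \<ge> 1" | "m = 0" "n = 0" "a \<noteq> 0"
    | "m = n" "n \<ge> 2" "a = 0" "dominated p M" | "m = 1" "n = 1" "a = 0" "dominated p M"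
    | "m + 1 = n" "a = 0" "m = 0" | "m + 1 = n" "a = 0" "n \<ge> 2" "dominated p M"
  proof -
    \<comment> \<open>\<open>dominated\<close> provides a Blossom favouring the opponent, so it
      excludes \<open>m = n = 0\<close>.\<close>
    have "m = n \<Longrightarrow> dominated p M \<Longrightarrow> n \<ge> 1"
      using num_favouring_eq_0_iff[of "opponent p" M] unfolding n_def dominated_def
      by (cases "num_favouring (opponent p) M") auto
    then show thesis
      using that win unfolding winning_def Let_def m_def[symmetric] n_def[symmetric] a_def[symmetric]
      by (metis One_nat_def Suc_1 Suc_eq_plus1 add_0 le_antisym not_less_eq_eq numeral_3_eq_3 zero_le)
  qed
  then show ?thesis
  proof cases
    case 1
    then obtain k where "n = Suc k" by (cases n) auto
    then show ?thesis
      using cut_other[of k] 1 by (auto simp: safe_def Let_def)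
  next
    case 2
    then obtain k where "m = Suc k" by (cases m) auto
    then show ?thesis
      using cut_own[of k] 2 by (auto simp: safe_def Let_def)
  next
    case 3
    \<comment> \<open>For \<open>a = 0\<close>, cutting an own stem would leave \<open>m = 1\<close>
      and \<open>a = 0\<close>, which is not safe. Moving in a Blossom leaves \<open>m = 2\<close>,
      or \<open>m = 1\<close> with Nim value 1.\<close>
    show ?thesis
    proof (cases "a = 0")
      case True
      then show ?thesis
        using own_blossom 3 by (auto simp: safe_def Let_def)
    next
      case False
      then show ?thesis
        using cut_own[of 1] 3 by (auto simp: safe_def Let_def)
    qed
  next
    case 4
    show ?thesis
    proof (cases "a < 2")
      case True
      then consider "a = 0" | "a = 1" by linarith
      then show ?thesis
      proof cases
        case 1
        then show ?thesis
          using cut_own[of 0] 4 by (auto simp: safe_def Let_def)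
      next
        \<comment> \<open>The move in the Blossom leaves \<open>m = 1\<close> and
          \<open>a = 1\<close>, or \<open>m = 0\<close> and Nim value 0.\<close>
        case 2
        then show ?thesis
          using own_blossom 4 by (auto simp: safe_def Let_def)
      qed
    next
      case False
      \<comment> \<open>Blossoms count as heaps of size 1, so a Nim value of at least 2 comes with a
        Stalk of height at least 2. Cutting it down to 0 or 1 gives two different Nim values, one of
        which is nonzero.\<close>
      then have "\<not> nim_value c (image_mset (\<lambda>_. 1) {#B \<in># M. neutral B#} + N) < 2"
        by (simp add: a_def nimber_def)
      then obtain h where "h \<in># image_mset (\<lambda>_. 1) {#B \<in># M. neutral B#} + N" "2 \<le> h"
        using nim_value_ge_2 by blast
      then have "h \<in># N" by auto
      then obtain N' where N: "N = add_mset h N'" by (metis multi_member_split)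
      have "nimber c M (add_mset 0 N') \<noteq> nimber c M (add_mset 1 N')"
        using nimber_move_stalk[of 0 1 c M N'] by simp
      then obtain h' where "h' < 2" "nimber c M (add_mset h' N') \<noteq> 0"
        by (metis one_less_numeral_iff semiring_norm(76) zero_less_numeral)
      then show ?thesis
        using has_safe_option_stalk[OF N _ rb, of h' c p] \<open>2 \<le> h\<close> 4
        by (simp add: safe_def m_def[symmetric] n_def[symmetric])
    qed
  next
    case 5
    then obtain k where "n = Suc k" by (cases n) auto
    then show ?thesis
      using cut_other[of k] 5 by (auto simp: safe_def Let_def)
  next
    case 6
    then have neutral: "neutral B" if "B \<in># M" for B
      using that num_favouring_eq_0_iff unfolding m_def n_def neutral_iff[of B p] by metis
    let ?K = "image_mset (\<lambda>_. 1) {#B \<in># M. neutral B#} + N"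
    consider "c = Misere" "\<forall>h \<in># ?K. h = 0"
      | h h' K' where "?K = add_mset h K'" "h' < h" "nim_value c (add_mset h' K') = 0"
      using nim_value_winning_move[of c ?K] 6(3) unfolding a_def nimber_def by blast
    then show ?thesis
    proof cases
      case 1
      then have "M = {#}"
        using neutral by (cases M) auto
      moreover have "\<forall>h \<in># N. h = 0" using 1(2) by auto
      ultimately have "X |\<notin>| opts p (position M N)" for X
        by (auto elim!: position_option_cases)
      then show ?thesis using 1(1) by auto
    next
      case 2
      show ?thesis
      proof (cases "h \<in># N")
        case True
        then obtain N' where N: "N = add_mset h N'" by (metis multi_member_split)
        then have "K' = image_mset (\<lambda>_. 1) {#B \<in># M. neutral B#} + N'"
          using 2(1) by simp
        then have "nimber c M (add_mset h' N') = 0"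
          using 2(3) by (simp add: nimber_def)
        then have "safe c p M (add_mset h' N')"
          using 6 by (simp add: safe_def m_def[symmetric] n_def[symmetric])
        then show ?thesis
          using has_safe_option_stalk[OF N 2(2) rb] by blast
      next
        \<comment> \<open>The Nim move removes a heap that stands for a neutral Blossom; on the
          board this is the cut of its stem.\<close>
        case False
        have "h \<in># ?K" using 2(1) by simp
        then obtain B where B: "B \<in># M" "h = 1" using False by auto
        then obtain M' where M: "M = add_mset B M'" by (metis multi_member_split)
        have "K' = image_mset (\<lambda>_. 1) {#B \<in># M'. neutral B#} + N"
          using 2(1) B neutral[OF B(1)] M by simp
        moreover have "h' = 0" using 2(2) B by simp
        ultimately have "nimber c M' N = 0"
          using 2(3) by (simp add: nimber_def nim_value_add_0)
        moreover have "num_favouring p M' = 0" "num_favouring (opponent p) M' = 0"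
          using 6 M unfolding m_def n_def by (auto split: if_splits)
        ultimately have "safe c p M' N"
          by (simp add: safe_def)
        then show ?thesis
          using has_safe_option_stem[OF M rb] by blast
      qed
    qed
  next
    case 7
    then show ?thesis
      using cut_other_dom by (auto simp: safe_def Let_def)
  next
    case 8
    obtain B M1 where B: "M = add_mset B M1" "favours p B" "num_favouring p M1 = 0"
      using 8(1) unfolding m_def One_nat_def by (rule num_favouring_SucE)
    have nB: "\<not> favours (opponent p) B" "\<not> neutral B"
      using B rb favours_opponent[of B p] by (auto simp: neutral_iff[of B p])
    then have "num_favouring (opponent p) M1 = Suc 0"
      using 8(2) B(1) unfolding n_def by simp
    then obtain C M2 where C: "M1 = add_mset C M2" "favours (opponent p) C" "num_favouring (opponent p) M2 = 0"
      by (rule num_favouring_SucE)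
    have nC: "\<not> favours p C" "\<not> neutral C"
      using B C rb favours_opponent[of C p] by (auto simp: neutral_iff[of C p])
    have M2: "num_favouring p M2 = 0" "nimber c M2 N = 0"
      using B C nB nC 8(3) unfolding a_def by auto
    have wins: "wins_moving_first Normal p (game_of B + game_of C)"
      using 8(4) B(2,1) C(1) M2(1) C(3) nB nC unfolding dominated_def num_favouring_eq_0_iff by auto
    \<comment> \<open>\<open>M2\<close> contains only neutral Blossoms, so \<open>balanced\<close>
      concerns this one pair.\<close>
    have safeI: "safe c p (add_mset B' (add_mset C' M2)) N"
      if "favours p B'" "\<not> favours (opponent p) B'" "favours (opponent p) C'" "\<not> favours p C'"
        "\<not> wins_moving_first Normal (opponent p) (game_of B' + game_of C')" for B' C'
    proof -
      have "\<not> neutral B'" "\<not> neutral C'"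
        using that by (auto simp: neutral_iff[of _ p])
      moreover have "balanced p (add_mset B' (add_mset C' M2))"
        using that M2 C(3) unfolding balanced_def by (auto simp: num_favouring_eq_0_iff)
      ultimately show ?thesis
        using that M2 C(3) by (simp add: safe_def)
    qed
    obtain X where X: "X |\<in>| opts p (game_of B + game_of C)" "\<not> wins_moving_first Normal (opponent p) X"
      using wins wins_normal_iff by blast
    from X(1) show ?thesis
      unfolding opts_add_iff
    proof (elim disjE exE conjE)
      fix Y assume Y: "Y |\<in>| opts p (game_of B)" "X = Y + game_of C"
      obtain B' where B': "blossom_move p B B'" "Y = game_of B'"
        using opts_game_of_blossom[OF Y(1)] .
      \<comment> \<open>A winning move in the sum cannot bring \<open>B\<close> to 0 or below, since
        \<open>C\<close> would then decide the sum for the opponent.\<close>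
      have "favours p B'"
      proof (rule ccontr)
        assume "\<not> favours p B'"
        then have "wins_moving_first Normal (opponent p) (game_of B' + game_of C)"
          using not_wins_add[of p "game_of B'" "game_of C"] C(2) unfolding favours_def by blast
        then show False using X(2) Y(2) B'(2) by simp
      qed
      moreover have "\<not> favours (opponent p) B'"
        using calculation favours_opponent blossom_move_red_blue[OF B'(1)] rb B(1) by auto
      ultimately have "safe c p (add_mset B' M1) N"
        using safeI[of B' C] C(1,2) nC X(2) Y(2) B'(2) by simp
      then show ?thesis
        using has_safe_option_blossom[OF B(1) rb B'(1)] by blast
    next
      fix Y assume Y: "Y |\<in>| opts p (game_of C)" "X = game_of B + Y"
      obtain C' where C': "blossom_move p C C'" "Y = game_of C'"
        using opts_game_of_blossom[OF Y(1)] .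
      have q: "favours (opponent p) C'"
        using favours_after_opponent_move[of "opponent p" C C'] nC C'(1) by simp
      moreover have "\<not> favours p C'"
        using favours_opponent[OF _ q] blossom_move_red_blue[OF C'(1)] rb B(1) C(1) by auto
      ultimately have "safe c p (add_mset C' (add_mset B M2)) N"
        using safeI[of B C'] B(2) nB X(2) Y(2) C'(2) by (simp add: add_mset_commute)
      moreover have "M = add_mset C (add_mset B M2)"
        using B(1) C(1) by (simp add: add_mset_commute)
      ultimately show ?thesis
        using has_safe_option_blossom[OF _ rb C'(1)] by blast
    qed
  next
    case 9
    then show ?thesis
      using cut_other[of 0] by (auto simp: safe_def Let_def)
  next
    case 10
    then show ?thesis
      using cut_other_dom by (auto simp: safe_def Let_def)
  qed
qed

text \<open>Every move from a safe position leads to a winning one and some move from a winning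
  position to a safe one, so each half feeds the other. The conventions differ only at positions
  without moves.\<close>

lemma safe_and_winning_positions:
  fixes M :: "'v hackenbush multiset"
  assumes "\<forall>B \<in># M. red_blue_position B"
  shows "(safe c p M N \<longrightarrow> \<not> wins_moving_first c (opponent p) (position M N)) \<and>
    (winning c p M N \<longrightarrow> wins_moving_first c p (position M N))"
  using assms
proof (induction "size (position M N)" arbitrary: M N rule: less_induct)
  case less
  show ?case
  proof (intro conjI impI)
    assume safe: "safe c p M N"
    have "wins_moving_first c p X" if X: "X |\<in>| opts (opponent p) (position M N)" for X
    proof -
      obtain M' :: "'v hackenbush multiset" and N' where *: "X = position M' N'"
        "\<forall>B \<in># M'. red_blue_position B" "winning c p M' N'"
        using winning_after_opponent_move[OF less(2) safe X] by blast
      then show ?thesis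
        using less(1)[of M' N'] size_option_less[OF X] by blast
    qed
    moreover have "c = Misere \<Longrightarrow> opts (opponent p) (position M N) \<noteq> {||}"
      using safe safe_has_move by blast
    ultimately show "\<not> wins_moving_first c (opponent p) (position M N)"
      by (subst wins_moving_first.simps) auto
  next
    assume win: "winning c p M N"
    show "wins_moving_first c p (position M N)"
      using winning_has_safe_option[OF less(2) win]
    proof
      assume "c = Misere \<and> opts p (position M N) = {||}"
      then show ?thesis by (subst wins_moving_first.simps) auto
    next
      assume "has_safe_option c p M N"
      then obtain M' :: "'v hackenbush multiset" and N' where
        *: "position M' N' |\<in>| opts p (position M N)" "\<forall>B \<in># M'. red_blue_position B" "safe c p M' N'"
        unfolding has_safe_option_def by blast
      then show ?thesis
        using less(1)[of M' N'] size_option_less[OF *(1)] wins_moving_firstI by blast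
    qed
  qed
qed

section \<open>From the values of the initial Blossoms to the outcomes\<close>

lemma sum_list_eq_sum_mset: "(\<Sum>x\<leftarrow>xs. f x) = (\<Sum>x\<in>#mset xs. f x)"
  by (simp flip: mset_map sum_mset_sum_list)

lemma favours_blossom:
  assumes "blossom_of_value B x" "of_int (player_sign p) * x > 0"
  shows "favours p B"
  using assms normal_value_wins unfolding favours_def blossom_of_value_def by blast

lemma num_favouring_all: "\<forall>B \<in># M. favours p B \<Longrightarrow> num_favouring p M = size M"
  by (induction M) auto

lemma num_favouring_none: "\<forall>B \<in># M. \<not> favours p B \<Longrightarrow> num_favouring p M = 0"
  by (simp add: num_favouring_eq_0_iff)

lemma num_favouring_union: "num_favouring p (M + M') = num_favouring p M + num_favouring p M'"
  by (simp add: num_favouring_def)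

lemma list_all2_Min:
  assumes "list_all2 P Bs xs" "xs \<noteq> []"
  obtains B where "B \<in> set Bs" "P B (Min (set xs))"
proof -
  have "Min (set xs) \<in> set xs" using assms(2) by simp
  then show thesis
    using assms(1) that by (metis in_set_conv_nth list_all2_conv_all_nth)
qed

lemma list_all2_ex: "list_all2 P Bs xs \<Longrightarrow> B \<in> set Bs \<Longrightarrow> \<exists>x \<in> set xs. P B x"
  by (metis in_set_conv_nth list_all2_conv_all_nth)

theorem theorem4p8:
  fixes Bs Cs :: "'v hackenbush list"
    and xs ys :: "rat list"
    and hs :: "nat list"
    and a :: nat
    and G G_twin :: game
    and \<Delta> :: int
    and \<epsilon> :: rat
  assumes pos_blossoms: "list_all2 blossom_of_value Bs xs"
    and neg_blossoms: "list_all2 (\<lambda>C y. blossom_of_value C (- y)) Cs ys"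
    and xs_order: "sorted xs" "\<forall>x \<in> set xs. 0 < x"
    and ys_order: "sorted ys" "\<forall>y \<in> set ys. 0 < y"
    and no_common: "set xs \<inter> set ys = {}"
    and G: "G = (\<Sum>B\<leftarrow>Bs. game_of (generalized_sprig B))
              + (\<Sum>C\<leftarrow>Cs. game_of (generalized_sprig C))
              + stalk_sum hs"
    and twin: "G_twin = evil_twin hs G"
    and a: "a = nim_sum hs"
    and \<Delta>: "\<Delta> = int (length xs) - int (length ys)"
    and \<epsilon>: "\<epsilon> = min_difference xs ys"
  shows
    "(\<bar>\<Delta>\<bar> \<ge> 2 \<longrightarrow>
        o\<^sup>+ G = o\<^sup>- G_twin \<and>
        (\<Delta> \<ge> 2 \<longrightarrow> o\<^sup>+ G = \<L>) \<and>
        (\<Delta> \<le> -2 \<longrightarrow> o\<^sup>+ G = \<R>)) \<and>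
     (\<bar>\<Delta>\<bar> = 1 \<longrightarrow>
        o\<^sup>+ G = o\<^sup>- G_twin \<and>
        ((\<Delta> = 1 \<and> \<epsilon> \<le> 0 \<and> a = 0) \<or> (\<Delta> = -1 \<and> \<epsilon> \<ge> 0 \<and> a = 0) \<longrightarrow> o\<^sup>+ G = \<N>) \<and>
        ((\<Delta> = 1 \<and> \<epsilon> > 0 \<and> a = 0) \<or> (\<Delta> = 1 \<and> a \<noteq> 0) \<longrightarrow> o\<^sup>+ G = \<L>) \<and>
        ((\<Delta> = -1 \<and> \<epsilon> < 0 \<and> a = 0) \<or> (\<Delta> = -1 \<and> a \<noteq> 0) \<longrightarrow> o\<^sup>+ G = \<R>)) \<and>
     (\<Delta> = 0 \<longrightarrow>
        o\<^sup>+ G = o\<^sup>- G_twin \<and>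
        (a \<noteq> 0 \<longrightarrow> o\<^sup>+ G = \<N>) \<and>
        (\<epsilon> = 0 \<and> a = 0 \<longrightarrow> o\<^sup>+ G = \<P>) \<and>
        (\<epsilon> > 0 \<and> a = 0 \<longrightarrow> o\<^sup>+ G = \<L>) \<and>
        (\<epsilon> < 0 \<and> a = 0 \<longrightarrow> o\<^sup>+ G = \<R>))"
proof -
  define M where "M = mset Bs + mset Cs"
  \<comment> \<open>The Stalks of \<open>G\<close> in normal play and of its evil twin in misere
    play.\<close>
  define N where "N c = mset hs + (if c = Misere \<and> (\<forall>h \<in> set hs. h < 2) then {#1#} else {#})" for c
  define m where "m = length xs"
  define n where "n = length ys"
  have Bs: "\<exists>x \<in> set xs. blossom_of_value B x" if "B \<in> set Bs" for B
    using list_all2_ex[OF pos_blossoms that] .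
  have Cs: "\<exists>y \<in> set ys. blossom_of_value C (- y)" if "C \<in> set Cs" for C
    using list_all2_ex[OF neg_blossoms that] .
  have rb: "\<forall>B \<in># M. red_blue_position B"
    using Bs Cs unfolding M_def red_blue_position_def blossom_of_value_def by fastforce
  have "favours Left B" if "B \<in> set Bs" for B
    using Bs[OF that] favours_blossom[of B _ Left] xs_order(2) by auto
  moreover from this have "\<not> favours Right B" if "B \<in> set Bs" for B
    using favours_opponent[of B Left] rb that by (simp add: M_def)
  ultimately have favB: "\<forall>B \<in> set Bs. favours Left B \<and> \<not> favours Right B" by blast
  have "favours Right C" if "C \<in> set Cs" for C
    using Cs[OF that] favours_blossom[of C _ Right] ys_order(2) by auto
  moreover from this have "\<not> favours Left C" if "C \<in> set Cs" for C
    using favours_opponent[of C Right] rb that by (simp add: M_def)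
  ultimately have favC: "\<forall>C \<in> set Cs. favours Right C \<and> \<not> favours Left C" by blast
  have num: "num_favouring Left M = m" "num_favouring Right M = n"
    using favB favC list_all2_lengthD[OF pos_blossoms] list_all2_lengthD[OF neg_blossoms]
    by (simp_all add: M_def m_def n_def num_favouring_union num_favouring_all num_favouring_none)
  have no_neutral: "{#B \<in># M. neutral B#} = {#}"
    using favB favC by (auto simp: M_def neutral_def filter_mset_eq_conv)
  have nimber: "nimber c M (N c) = a" for c
  proof (cases "c = Misere \<and> (\<forall>h \<in> set hs. h < 2)")
    case True
    then have "nimber c M (N c) = Bit_Operations.xor 1 (nim_value c (mset hs))"
      by (simp add: nimber_def no_neutral N_def nim_value_add_1 del: One_nat_def)
    also have "\<dots> = Bit_Operations.xor 1 (Bit_Operations.xor a 1)"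
      using True by (simp add: nim_value_def a nim_sum_eq_xor_mset)
    also have "\<dots> = a"
      by (metis xor.commute xor.assoc xor_self_eq xor.left_neutral)
    finally show ?thesis .
  next
    case False
    then have "N c = mset hs" by (auto simp: N_def)
    then show ?thesis
      using False by (auto simp: nimber_def no_neutral nim_value_def a nim_sum_eq_xor_mset)
  qed
  have position: "position M (N Normal) = G" "position M (N Misere) = G_twin"
  proof -
    have "position M (mset hs) = G"
      by (simp add: position_def M_def G stalk_sum_def sum_list_eq_sum_mset)
    moreover have "position M (mset hs + {#1#}) = position M (mset hs) + game_of (stalk 1)"
      by (simp add: position_def add_ac)
    ultimately show "position M (N Normal) = G" "position M (N Misere) = G_twin"
      by (auto simp: N_def twin evil_twin_def not_le[symmetric])
  qed
  have dominated_Left: "dominated Left M" if "\<epsilon> > 0"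
  proof -
    have ne: "xs \<noteq> []" "ys \<noteq> []" and less: "Min (set ys) < Min (set xs)"
      using that by (auto simp: \<epsilon> min_difference_def split: if_splits)
    obtain C where C: "C \<in> set Cs" "blossom_of_value C (- Min (set ys))"
      using list_all2_Min[OF neg_blossoms ne(2)] .
    have "wins_moving_first Normal Left (game_of B + game_of C)" if in_Bs: "B \<in> set Bs" for B
    proof -
      obtain x where x: "x \<in> set xs" "blossom_of_value B x" using Bs[OF in_Bs] by blast
      have "Min (set ys) < x"
        using less Min_le[OF _ x(1)] by simp
      then show ?thesis
        using normal_value_add_wins[of "game_of B" x "game_of C" "- Min (set ys)" Left] x(2) C(2)
        by (auto simp: blossom_of_value_def)
    qed
    then show ?thesis
      using C(1) favB favC unfolding dominated_def M_def by auto
  qed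
  have dominated_Right: "dominated Right M" if "\<epsilon> < 0"
  proof -
    have ne: "xs \<noteq> []" "ys \<noteq> []" and less: "Min (set xs) < Min (set ys)"
      using that by (auto simp: \<epsilon> min_difference_def split: if_splits)
    obtain B where B: "B \<in> set Bs" "blossom_of_value B (Min (set xs))"
      using list_all2_Min[OF pos_blossoms ne(1)] .
    have "wins_moving_first Normal Right (game_of C + game_of B)" if in_Cs: "C \<in> set Cs" for C
    proof -
      obtain y where y: "y \<in> set ys" "blossom_of_value C (- y)" using Cs[OF in_Cs] by blast
      have "Min (set xs) < y"
        using less Min_le[OF _ y(1)] by simp
      then show ?thesis
        using normal_value_add_wins[of "game_of C" "- y" "game_of B" "Min (set xs)" Right] y(2) B(2)
        by (auto simp: blossom_of_value_def)
    qed
    then show ?thesis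
      using B(1) favB favC unfolding dominated_def M_def by auto
  qed
  \<comment> \<open>The minima differ because the lists are disjoint, so
    \<open>\<epsilon> = 0\<close> can only be the default value for an empty list.\<close>
  have \<epsilon>_0: "m = 0 \<or> n = 0" if "\<epsilon> = 0"
  proof (rule ccontr)
    assume "\<not> ?thesis"
    then have ne: "xs \<noteq> []" "ys \<noteq> []" by (auto simp: m_def n_def)
    then have "Min (set xs) = Min (set ys)" using that by (simp add: \<epsilon> min_difference_def)
    then show False
      using no_common Min_in[of "set xs"] Min_in[of "set ys"] ne by auto
  qed
  \<comment> \<open>Covers the default \<open>\<epsilon> = 0\<close> when the counts differ by one:
    the side without Blossoms wins moving first if \<open>a = 0\<close>.\<close>
  have dominated_empty: "m = 0 \<Longrightarrow> n > 0 \<Longrightarrow> dominated Left M" "n = 0 \<Longrightarrow> m > 0 \<Longrightarrow> dominated Right M"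
    using dominated_no_favouring[of Left M] dominated_no_favouring[of Right M] num by auto
  \<comment> \<open>The last branch collects equal counts with \<open>a \<noteq> 0\<close>, and a
    difference of one with \<open>a = 0\<close> where \<open>\<epsilon>\<close> does not favour the
    more numerous side.\<close>
  define out where "out =
    (if \<Delta> \<ge> 2 \<or> \<Delta> = 1 \<and> (a \<noteq> 0 \<or> \<epsilon> > 0) \<or> \<Delta> = 0 \<and> a = 0 \<and> \<epsilon> > 0 then \<L>
     else if \<Delta> \<le> -2 \<or> \<Delta> = -1 \<and> (a \<noteq> 0 \<or> \<epsilon> < 0) \<or> \<Delta> = 0 \<and> a = 0 \<and> \<epsilon> < 0 then \<R>
     else if \<Delta> = 0 \<and> a = 0 then \<P> else \<N>)"
  have outcome: "outcome c (position M (N c)) = out" for c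
  proof -
    let ?W = "\<lambda>p. wins_moving_first c p (position M (N c))"
    have mn: "\<Delta> = int m - int n" by (simp add: \<Delta> m_def n_def)
    have eps: "\<epsilon> > 0 \<and> dominated Left M \<or> \<epsilon> < 0 \<and> dominated Right M \<or> \<epsilon> = 0 \<and> (m = 0 \<or> n = 0)"
      using dominated_Left dominated_Right \<epsilon>_0 by (cases \<epsilon> "0 :: rat" rule: linorder_cases) simp_all
    have not_Right: "\<not> ?W Right"
      if "n + 2 \<le> m \<or> m = n + 1 \<and> (a \<noteq> 0 \<or> \<epsilon> > 0) \<or> m = n \<and> a = 0 \<and> \<epsilon> \<ge> 0"
    proof -
      have "safe c Left M (N c)"
        using that eps by (auto simp: safe_def num nimber)
      then show ?thesis
        using safe_and_winning_positions[OF rb, of c Left "N c"] by simp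
    qed
    have not_Left: "\<not> ?W Left"
      if "m + 2 \<le> n \<or> n = m + 1 \<and> (a \<noteq> 0 \<or> \<epsilon> < 0) \<or> m = n \<and> a = 0 \<and> \<epsilon> \<le> 0"
    proof -
      have "safe c Right M (N c)"
        using that eps by (auto simp: safe_def num nimber)
      then show ?thesis
        using safe_and_winning_positions[OF rb, of c Right "N c"] by simp
    qed
    have Left: "?W Left"
      if "n + 1 \<le> m \<or> m = n \<and> (a \<noteq> 0 \<or> \<epsilon> > 0) \<or> m + 1 = n \<and> a = 0 \<and> \<epsilon> \<ge> 0"
    proof -
      have "winning c Left M (N c)"
        using that eps dominated_empty(1) by (auto simp: winning_def num nimber)
      then show ?thesis
        using safe_and_winning_positions[OF rb, of c Left "N c"] by simp
    qed
    have Right: "?W Right"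
      if "m + 1 \<le> n \<or> m = n \<and> (a \<noteq> 0 \<or> \<epsilon> < 0) \<or> n + 1 = m \<and> a = 0 \<and> \<epsilon> \<le> 0"
    proof -
      have "winning c Right M (N c)"
        using that eps dominated_empty(2) by (auto simp: winning_def num nimber)
      then show ?thesis
        using safe_and_winning_positions[OF rb, of c Right "N c"] by simp
    qed
    consider "m \<ge> n + 2" | "n \<ge> m + 2" | "m = n + 1" | "n = m + 1" | "m = n" by linarith
    then show ?thesis
    proof cases
      case 1
      then show ?thesis
        using not_Right Left mn by (simp add: outcome_def out_def)
    next
      case 2
      then show ?thesis
        using not_Left Right mn by (simp add: outcome_def out_def)
    next
      case 3
      then show ?thesis
        using not_Right Left Right mn
        by (cases "a = 0"; cases "\<epsilon> > 0") (simp_all add: outcome_def out_def)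
    next
      case 4
      then show ?thesis
        using not_Left Left Right mn
        by (cases "a = 0"; cases "\<epsilon> < 0") (simp_all add: outcome_def out_def)
    next
      case 5
      then show ?thesis
        using not_Right not_Left Left Right mn
        by (cases "a = 0"; cases \<epsilon> "0 :: rat" rule: linorder_cases) (simp_all add: outcome_def out_def)
    qed
  qed
  have "o\<^sup>+ G = out" "o\<^sup>- G_twin = out"
    using outcome[of Normal] outcome[of Misere] position by simp_all
  then show ?thesis
    by (auto simp: out_def)
qed

end
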